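(* If $G$ is a finitely generated torsion free nilpotent group, then the commensurator $\mathrm{Comm}(G)$ is isomorphic to the automorphism group $\mathrm{Aut}(L)$ of the rational Lie algebra $L=\mathcal{L}(\sqrt{G})$ corresponding to the divisible hull $\sqrt{G}$ of $G$ under the Malcev correspondence.
   Context: Commensurator: a virtual automorphism of $G$ is an isomorphism $\varphi:H\to K$ between subgroups $H,K$ of finite index in $G$. Two virtual automorphisms $\varphi:H\to K$, $\varphi':H'\to K'$ are equivalent if they coincide on some subgroup of finite index in both $H$ and $H'$. Virtual automorphisms are composed as partial mappings; the set of equivalence classes is a group under the induced product, denoted $\mathrm{Comm}(G)$. Divisible hull: a group $D$ is divisible if for all $a\in D$ and $n\ge1$ there is $x\in D$ with $x^n=a$. For a torsion free nilpotent group $G$, $\sqrt{G}$ denotes its divisible hull: a torsion free divisible nilpotent group containing $G$ such that each $h\in\sqrt{G}$ has a power $h^n\in G$ with $n>0$ (it exists and is unique up to a unique isomorphism extending the identity of $G$). Malcev correspondence: for a nilpotent Lie algebra $L$ over $\mathbb{Q}$, the Baker–Campbell–Hausdorff operation $x\circ y=\log(\exp x\exp y)=x+y+\frac12(x,y)+\frac1{12}(x,(x,y))-\frac1{12}(y,(x,y))+\cdots$, where $(\cdot,\cdot)$ is the Lie bracket, makes the set $L$ a torsion free divisible nilpotent group. For a torsion free divisible nilpotent group $D$, $\mathcal{L}(D)$ is the unique rational nilpotent Lie algebra on the same underlying set whose Baker–Campbell–Hausdorff group is $D$, with scalar multiplication $qa=a^q$ ($q\in\mathbb{Q}$). *)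

theory Defs
  imports "HOL-Algebra.Algebra" "HOL-Algebra.Algebraic_Closure_Type"
begin

section \<open>Groups\<close>

definition finitely_generated :: "('a, 'b) monoid_scheme \<Rightarrow> bool" where
  "finitely_generated G \<longleftrightarrow> (\<exists>S. finite S \<and> S \<subseteq> carrier G \<and> generate G S = carrier G)"

definition torsion_free :: "('a, 'b) monoid_scheme \<Rightarrow> bool" where
  "torsion_free G \<longleftrightarrow>
     (\<forall>x\<in>carrier G. \<forall>n::nat. n > 0 \<longrightarrow> x [^]\<^bsub>G\<^esub> n = \<one>\<^bsub>G\<^esub> \<longrightarrow> x = \<one>\<^bsub>G\<^esub>)"

primrec lower_central :: "('a, 'b) monoid_scheme \<Rightarrow> nat \<Rightarrow> 'a set" where
  "lower_central G 0 = carrier G"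
| "lower_central G (Suc n) = generate G
     {x \<otimes>\<^bsub>G\<^esub> y \<otimes>\<^bsub>G\<^esub> inv\<^bsub>G\<^esub> x \<otimes>\<^bsub>G\<^esub> inv\<^bsub>G\<^esub> y | x y. x \<in> carrier G \<and> y \<in> lower_central G n}"

definition nilpotent_group :: "('a, 'b) monoid_scheme \<Rightarrow> bool" where
  "nilpotent_group G \<longleftrightarrow> group G \<and> (\<exists>n. lower_central G n = {\<one>\<^bsub>G\<^esub>})"

definition divisible_group :: "('a, 'b) monoid_scheme \<Rightarrow> bool" where
  "divisible_group D \<longleftrightarrow>
     group D \<and> (\<forall>a\<in>carrier D. \<forall>n::nat. n \<ge> 1 \<longrightarrow> (\<exists>x\<in>carrier D. x [^]\<^bsub>D\<^esub> n = a))"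

text \<open>The divisible hull is determined only up to isomorphism over \<open>G\<close>, so it is a property of a
  group \<open>D\<close> together with the embedding \<open>\<iota>\<close> by which it contains \<open>G\<close>.\<close>

definition is_divisible_hull ::
  "('a, 'b) monoid_scheme \<Rightarrow> ('a \<Rightarrow> 'd) \<Rightarrow> ('d, 'e) monoid_scheme \<Rightarrow> bool" where
  "is_divisible_hull G \<iota> D \<longleftrightarrow>
     nilpotent_group D \<and> torsion_free D \<and> divisible_group D \<and>
     \<iota> \<in> hom G D \<and> inj_on \<iota> (carrier G) \<and>
     (\<forall>h\<in>carrier D. \<exists>n::nat. n > 0 \<and> h [^]\<^bsub>D\<^esub> n \<in> \<iota> ` carrier G)"

text \<open>The power \<open>a\<^sup>q\<close> with rational exponent; roots are unique in a torsion free nilpotent group.\<close>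

definition rat_pow :: "('d, 'e) monoid_scheme \<Rightarrow> 'd \<Rightarrow> rat \<Rightarrow> 'd" where
  "rat_pow D a q = (THE x. x \<in> carrier D \<and>
     x [^]\<^bsub>D\<^esub> snd (quotient_of q) = a [^]\<^bsub>D\<^esub> fst (quotient_of q))"

section \<open>The commensurator\<close>

definition finite_index :: "'a set \<Rightarrow> ('a, 'b) monoid_scheme \<Rightarrow> bool" where
  "finite_index H G \<longleftrightarrow> subgroup H G \<and> finite (rcosets\<^bsub>G\<^esub> H)"

text \<open>A virtual automorphism \<open>H \<rightarrow> K\<close> is encoded as the partial map with domain \<open>H\<close> and range \<open>K\<close>,
  so that composition of virtual automorphisms is \<^term>\<open>map_comp\<close>.\<close>

definition virtual_autos :: "('a, 'b) monoid_scheme \<Rightarrow> ('a \<rightharpoonup> 'a) set" where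
  "virtual_autos G = {\<phi>. finite_index (dom \<phi>) G \<and> finite_index (ran \<phi>) G \<and>
     (\<lambda>x. the (\<phi> x)) \<in> iso (G\<lparr>carrier := dom \<phi>\<rparr>) (G\<lparr>carrier := ran \<phi>\<rparr>)}"

definition virtual_equiv :: "('a, 'b) monoid_scheme \<Rightarrow> (('a \<rightharpoonup> 'a) \<times> ('a \<rightharpoonup> 'a)) set" where
  "virtual_equiv G = {(\<phi>, \<psi>). \<phi> \<in> virtual_autos G \<and> \<psi> \<in> virtual_autos G \<and>
     (\<exists>M. finite_index M (G\<lparr>carrier := dom \<phi>\<rparr>) \<and> finite_index M (G\<lparr>carrier := dom \<psi>\<rparr>) \<and>
          (\<forall>x\<in>M. \<phi> x = \<psi> x))}"

definition Comm :: "('a, 'b) monoid_scheme \<Rightarrow> ('a \<rightharpoonup> 'a) set monoid" where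
  "Comm G =
     \<lparr>carrier = virtual_autos G // virtual_equiv G,
      monoid.mult = (\<lambda>A B. \<Union>\<phi>\<in>A. \<Union>\<psi>\<in>B. virtual_equiv G `` {\<phi> \<circ>\<^sub>m \<psi>}),
      one = virtual_equiv G `` {Some |` carrier G}\<rparr>"

section \<open>Lie algebras\<close>

text \<open>Only the module part of the record and the bracket are used; the ring fields \<^const>\<open>monoid.mult\<close> and
  \<^const>\<open>one\<close> inherited from \<open>module\<close> are unconstrained, as they are for modules.\<close>

record ('r, 'm) lie_alg = "('r, 'm) module" +
  bracket :: "'m \<Rightarrow> 'm \<Rightarrow> 'm"

locale lie_algebra = module R L
  for R :: "('r, 'b) ring_scheme" and L :: "('r, 'm, 'c) lie_alg_scheme" +
  assumes bracket_closed:
      "x \<in> carrier L \<Longrightarrow> y \<in> carrier L \<Longrightarrow> bracket L x y \<in> carrier L"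
    and bracket_add_left:
      "x \<in> carrier L \<Longrightarrow> y \<in> carrier L \<Longrightarrow> z \<in> carrier L \<Longrightarrow>
       bracket L (x \<oplus>\<^bsub>L\<^esub> y) z = bracket L x z \<oplus>\<^bsub>L\<^esub> bracket L y z"
    and bracket_add_right:
      "x \<in> carrier L \<Longrightarrow> y \<in> carrier L \<Longrightarrow> z \<in> carrier L \<Longrightarrow>
       bracket L x (y \<oplus>\<^bsub>L\<^esub> z) = bracket L x y \<oplus>\<^bsub>L\<^esub> bracket L x z"
    and bracket_smult_left:
      "a \<in> carrier R \<Longrightarrow> x \<in> carrier L \<Longrightarrow> y \<in> carrier L \<Longrightarrow>
       bracket L (a \<odot>\<^bsub>L\<^esub> x) y = a \<odot>\<^bsub>L\<^esub> bracket L x y"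
    and bracket_smult_right:
      "a \<in> carrier R \<Longrightarrow> x \<in> carrier L \<Longrightarrow> y \<in> carrier L \<Longrightarrow>
       bracket L x (a \<odot>\<^bsub>L\<^esub> y) = a \<odot>\<^bsub>L\<^esub> bracket L x y"
    and bracket_self: "x \<in> carrier L \<Longrightarrow> bracket L x x = \<zero>\<^bsub>L\<^esub>"
    and jacobi:
      "x \<in> carrier L \<Longrightarrow> y \<in> carrier L \<Longrightarrow> z \<in> carrier L \<Longrightarrow>
       bracket L x (bracket L y z) \<oplus>\<^bsub>L\<^esub> bracket L y (bracket L z x)
         \<oplus>\<^bsub>L\<^esub> bracket L z (bracket L x y) = \<zero>\<^bsub>L\<^esub>"

primrec lie_lower_central ::
  "('r, 'b) ring_scheme \<Rightarrow> ('r, 'm, 'c) lie_alg_scheme \<Rightarrow> nat \<Rightarrow> 'm set" where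
  "lie_lower_central R L 0 = carrier L"
| "lie_lower_central R L (Suc n) = (\<lambda>N. submodule N R L) hull
     {bracket L x y | x y. x \<in> carrier L \<and> y \<in> lie_lower_central R L n}"

definition nilpotent_lie_algebra ::
  "('r, 'b) ring_scheme \<Rightarrow> ('r, 'm, 'c) lie_alg_scheme \<Rightarrow> bool" where
  "nilpotent_lie_algebra R L \<longleftrightarrow>
     lie_algebra R L \<and> (\<exists>n. lie_lower_central R L n = {\<zero>\<^bsub>L\<^esub>})"

definition lie_auto ::
  "('r, 'b) ring_scheme \<Rightarrow> ('r, 'm, 'c) lie_alg_scheme \<Rightarrow> ('m \<Rightarrow> 'm) set" where
  "lie_auto R L = {f \<in> Bij (carrier L).
     (\<forall>x\<in>carrier L. \<forall>y\<in>carrier L. f (x \<oplus>\<^bsub>L\<^esub> y) = f x \<oplus>\<^bsub>L\<^esub> f y) \<and>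
     (\<forall>a\<in>carrier R. \<forall>x\<in>carrier L. f (a \<odot>\<^bsub>L\<^esub> x) = a \<odot>\<^bsub>L\<^esub> f x) \<and>
     (\<forall>x\<in>carrier L. \<forall>y\<in>carrier L. f (bracket L x y) = bracket L (f x) (f y))}"

definition LieAutoGroup ::
  "('r, 'b) ring_scheme \<Rightarrow> ('r, 'm, 'c) lie_alg_scheme \<Rightarrow> ('m \<Rightarrow> 'm) monoid" where
  "LieAutoGroup R L = BijGroup (carrier L) \<lparr>carrier := lie_auto R L\<rparr>"

abbreviation rat_ring :: "rat ring" where
  "rat_ring \<equiv> ring_of_type_algebra"

section \<open>The Baker--Campbell--Hausdorff operation\<close>

text \<open>Noncommutative formal power series over the rationals in the variables \<open>'x\<close>, given by their
  coefficients on words.  In \<open>nc_exp f\<close> and \<open>nc_log f\<close> the series \<open>f\<close> is assumed to have constant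
  term 0 and 1 respectively; then \<open>f ^ k\<close> and \<open>(f - 1) ^ k\<close> have no terms of degree less than
  \<open>k\<close>, so that truncating the sums at the length of the word loses nothing.\<close>

type_synonym 'x nc_series = "'x list \<Rightarrow> rat"

definition nc_one :: "'x nc_series" where
  "nc_one w = (if w = [] then 1 else 0)"

definition nc_var :: "'x \<Rightarrow> 'x nc_series" where
  "nc_var x w = (if w = [x] then 1 else 0)"

definition nc_mult :: "'x nc_series \<Rightarrow> 'x nc_series \<Rightarrow> 'x nc_series" where
  "nc_mult f g w = (\<Sum>i\<le>length w. f (take i w) * g (drop i w))"

primrec nc_pow :: "'x nc_series \<Rightarrow> nat \<Rightarrow> 'x nc_series" where
  "nc_pow f 0 = nc_one"
| "nc_pow f (Suc k) = nc_mult f (nc_pow f k)"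

definition nc_exp :: "'x nc_series \<Rightarrow> 'x nc_series" where
  "nc_exp f w = (\<Sum>k\<le>length w. nc_pow f k w / fact k)"

definition nc_log :: "'x nc_series \<Rightarrow> 'x nc_series" where
  "nc_log f w = (\<Sum>k = 1..length w. (-1) ^ (k + 1) / of_nat k * nc_pow (\<lambda>v. f v - nc_one v) k w)"

text \<open>\<open>log (exp X exp Y)\<close>, with \<open>X\<close> and \<open>Y\<close> the variables \<^const>\<open>True\<close> and \<^const>\<open>False\<close>.\<close>

definition bch_series :: "bool nc_series" where
  "bch_series = nc_log (nc_mult (nc_exp (nc_var True)) (nc_exp (nc_var False)))"

fun right_normed :: "('r, 'm, 'c) lie_alg_scheme \<Rightarrow> 'm list \<Rightarrow> 'm" where
  "right_normed L [] = \<zero>\<^bsub>L\<^esub>"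
| "right_normed L [a] = a"
| "right_normed L (a # b # as) = bracket L a (right_normed L (b # as))"

text \<open>Every homogeneous component of \<open>log (exp X exp Y)\<close> is a Lie polynomial, and by the
  Dynkin--Specht--Wever theorem a homogeneous Lie polynomial of degree \<open>n\<close> is recovered from its
  coefficients by replacing each word \<open>w\<close> with \<open>1/n\<close> times the right-normed bracket of its
  letters.  This is how the series is evaluated in a Lie algebra.  In a nilpotent Lie algebra only
  finitely many brackets are nonzero; restricting to these makes the sum a \<^const>\<open>finsum\<close>.\<close>

definition bch :: "(rat, 'm, 'c) lie_alg_scheme \<Rightarrow> 'm \<Rightarrow> 'm \<Rightarrow> 'm" where
  "bch L x y =
     (let br = (\<lambda>w. right_normed L (map (\<lambda>b. if b then x else y) w)) in
      finsum L (\<lambda>w. (bch_series w / of_nat (length w)) \<odot>\<^bsub>L\<^esub> br w) {w. br w \<noteq> \<zero>\<^bsub>L\<^esub>})"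

section \<open>The Malcev correspondence\<close>

text \<open>\<open>L\<close> is the rational Lie algebra \<open>\<L>(D)\<close> of the torsion free divisible nilpotent group \<open>D\<close>.\<close>

definition is_malcev_lie_algebra ::
  "('d, 'e) monoid_scheme \<Rightarrow> (rat, 'd, 'c) lie_alg_scheme \<Rightarrow> bool" where
  "is_malcev_lie_algebra D L \<longleftrightarrow>
     nilpotent_lie_algebra rat_ring L \<and>
     carrier L = carrier D \<and>
     (\<forall>x\<in>carrier D. \<forall>y\<in>carrier D. bch L x y = x \<otimes>\<^bsub>D\<^esub> y) \<and>
     (\<forall>q. \<forall>a\<in>carrier D. q \<odot>\<^bsub>L\<^esub> a = rat_pow D a q)"

end

theory Submission
  imports Defs
begin

text \<open>A virtual automorphism of \<open>G\<close> extends to the divisible hull by taking roots, that is, to a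
  map \<open>f\<close> of \<open>L\<close> that commutes with rational scalars.  On a subgroup meeting every line of \<open>L\<close> the
  map \<open>f\<close> preserves the Baker--Campbell--Hausdorff operation, and this already forces \<open>f\<close> to be
  linear and to preserve the bracket: modulo higher terms of the lower central series
  \<open>x * y\<close> is \<open>x + y\<close> and the difference of \<open>x * y\<close> and \<open>y * x\<close> is \<open>[x, y]\<close>, so one descends
  along that series.  Conversely an automorphism of \<open>L\<close> restricts to a virtual automorphism of
  \<open>G\<close>, because in a finitely generated nilpotent group a subgroup containing a power of every
  element has finite index.\<close>

section \<open>Subgroups of finite index in nilpotent groups\<close>

text \<open>Finite index is hard to follow from G to the hull and back, so it is traded for
  \<open>power_dense\<close>. For subgroups of a finitely generated nilpotent group the two notions
  agree, and powers in G become integer multiples in L, which can be checked one element at a time.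
  The obstacle in the descent is that f is known to respect the Baker-Campbell-Hausdorff operation
  only on the image of a subgroup of G, and that nothing is known about how f moves the lower
  central series. The operation is therefore rewritten as x + y plus a polynomial in ad x and ad y
  applied to the single bracket [x, y]. If y lies in some term of the series, every correction lies
  in the next term, where f is already under control. The difference of x * y and y * x has the same
  shape with constant coefficient 1/2 + 1/2 = 1. Such an operator is unipotent, hence injective on
  all of L, so the bracket can be recovered on the image side too.\<close>

definition power_dense :: "'a set \<Rightarrow> ('a, 'b) monoid_scheme \<Rightarrow> bool" where
  "power_dense H G \<longleftrightarrow>
     subgroup H G \<and> (\<forall>g\<in>carrier G. \<exists>n::nat. n > 0 \<and> g [^]\<^bsub>G\<^esub> n \<in> H)"

text \<open>Finite index of H in K by coset representatives inside the ambient group, so that towers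
  of subgroups can be handled without changing the carrier.\<close>

definition finitely_covered :: "('a, 'b) monoid_scheme \<Rightarrow> 'a set \<Rightarrow> 'a set \<Rightarrow> bool" where
  "finitely_covered G K H \<longleftrightarrow> (\<exists>R. finite R \<and> R \<subseteq> K \<and>
     (\<forall>x\<in>K. \<exists>r\<in>R. \<exists>h\<in>H. x = h \<otimes>\<^bsub>G\<^esub> r))"

context group
begin

section \<open>Finite index, coset representatives and powers\<close>

lemma inv_cancel_left:
  assumes "x \<in> carrier G" "y \<in> carrier G"
  shows "inv x \<otimes> (x \<otimes> y) = y" "x \<otimes> (inv x \<otimes> y) = y"
  using assms by (simp_all flip: m_assoc)

lemma finite_index_if_finitely_covered:
  assumes H: "subgroup H G" and fc: "finitely_covered G (carrier G) H"
  shows "finite_index H G"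
proof -
  obtain R where R: "finite R" "R \<subseteq> carrier G" "\<forall>x\<in>carrier G. \<exists>r\<in>R. \<exists>h\<in>H. x = h \<otimes> r"
    using fc unfolding finitely_covered_def by blast
  have "rcosets H \<subseteq> (\<lambda>r. H #> r) ` R"
  proof
    fix C assume "C \<in> rcosets H"
    then obtain g where g: "g \<in> carrier G" "C = H #> g" unfolding RCOSETS_def by blast
    then obtain r where r: "r \<in> R" "g \<in> H #> r" using R unfolding r_coset_def by blast
    then have "H #> r = H #> g" using repr_independence[OF _ _ H] R by blast
    then show "C \<in> (\<lambda>r. H #> r) ` R" using r g by blast
  qed
  then show ?thesis unfolding finite_index_def using H R(1) finite_surj by blast
qed

text \<open>Pigeonhole on the cosets of the powers of g: two of them coincide, and the quotient of
  these two powers is a positive power of g in H.\<close>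

lemma power_dense_if_finite_index:
  assumes fi: "finite_index H G"
  shows "power_dense H G"
proof -
  have H: "subgroup H G" and fin: "finite (rcosets H)" using fi by (auto simp: finite_index_def)
  have "\<exists>n::nat. n > 0 \<and> g [^] n \<in> H" if g: "g \<in> carrier G" for g
  proof -
    have "range (\<lambda>n::nat. H #> (g [^] n)) \<subseteq> rcosets H" using g unfolding RCOSETS_def by blast
    then have "\<not> inj (\<lambda>n::nat. H #> (g [^] n))"
      using fin finite_subset range_inj_infinite by blast
    then obtain i j :: nat where ij: "i < j" "H #> (g [^] i) = H #> (g [^] j)"
      unfolding inj_on_def by (metis linorder_neqE_nat)
    have "g [^] j \<in> H #> (g [^] i)" using ij g rcos_self[OF _ H] by simp
    then have "g [^] j \<otimes> inv (g [^] i) \<in> H"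
      using subgroup.rcos_module_imp[OF H is_group] g by simp
    moreover have "g [^] j = g [^] (j - i) \<otimes> g [^] i" using g ij by (simp add: nat_pow_mult)
    ultimately have "g [^] (j - i) \<in> H" using g by (simp add: m_assoc)
    then show ?thesis using ij by (intro exI[of _ "j - i"]) simp
  qed
  then show ?thesis using H by (simp add: power_dense_def)
qed

text \<open>Since s normalises M, the generated group is the product of M with the powers of s, and
  s^m in M lets the exponent be reduced modulo m. The two conjugation hypotheses serve positive and
  negative powers of s.\<close>

lemma generate_insert_cover:
  assumes M: "subgroup M G" and s: "s \<in> carrier G"
    and nrm: "\<And>a. a \<in> M \<Longrightarrow> s \<otimes> a \<otimes> inv s \<in> M" "\<And>a. a \<in> M \<Longrightarrow> inv s \<otimes> a \<otimes> s \<in> M"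
    and m: "m > 0" "s [^] (m::nat) \<in> M"
    and x: "x \<in> generate G (insert s M)"
  shows "\<exists>e<m. \<exists>a\<in>M. x = a \<otimes> s [^] e"
proof -
  note Mc = subgroup.mem_carrier[OF M]
  have nrmn: "s [^] n \<otimes> a \<otimes> inv (s [^] n) \<in> M \<and> inv (s [^] n) \<otimes> a \<otimes> s [^] n \<in> M"
    if "a \<in> M" for a and n :: nat
    using that
  proof (induction n arbitrary: a)
    case 0 then show ?case using Mc by simp
  next
    case (Suc n)
    have "s [^] Suc n \<otimes> a \<otimes> inv (s [^] Suc n) = s [^] n \<otimes> (s \<otimes> a \<otimes> inv s) \<otimes> inv (s [^] n)"
      using s Mc[OF Suc.prems] by (simp add: inv_mult_group m_assoc)
    moreover have "inv (s [^] Suc n) \<otimes> a \<otimes> s [^] Suc n = inv s \<otimes> (inv (s [^] n) \<otimes> a \<otimes> s [^] n) \<otimes> s"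
      using s Mc[OF Suc.prems] by (simp add: inv_mult_group m_assoc)
    ultimately show ?case using Suc nrm by metis
  qed
  have nrmk: "s [^] k \<otimes> a \<otimes> s [^] (- k) \<in> M" if "a \<in> M" for a and k :: int
  proof (cases k)
    case (nonneg n)
    then show ?thesis using nrmn[OF that, of n] s by (simp add: int_pow_int int_pow_neg)
  next
    case (neg n)
    then show ?thesis using nrmn[OF that, of "Suc n"] s by (simp add: int_pow_int int_pow_neg del: of_nat_Suc)
  qed
  \<comment> \<open>Integer exponents come first because \<open>generate\<close> also admits
    inverses of generators; they are bounded afterwards.\<close>
  from x have "\<exists>a\<in>M. \<exists>k::int. x = a \<otimes> s [^] k"
  proof (induction)
    case one
    then show ?case using subgroup.one_closed[OF M] by (metis int_pow_0 one_closed r_one)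
  next
    case (incl h)
    show ?case
    proof (cases "h = s")
      case True
      then have "h = \<one> \<otimes> s [^] (1::int)" using s by (simp add: int_pow_1)
      then show ?thesis using subgroup.one_closed[OF M] by blast
    next
      case False
      then have "h \<in> M" using incl by simp
      moreover have "h = h \<otimes> s [^] (0::int)" using Mc[OF \<open>h \<in> M\<close>] by simp
      ultimately show ?thesis by blast
    qed
  next
    case (inv h)
    show ?case
    proof (cases "h = s")
      case True
      then have "inv h = \<one> \<otimes> s [^] (-1::int)" using s by (simp add: int_pow_neg int_pow_1)
      then show ?thesis using subgroup.one_closed[OF M] by blast
    next
      case False
      then have "h \<in> M" using inv by simp
      then have "inv h \<in> M" using subgroup.m_inv_closed[OF M] by simp
      moreover have "inv h = inv h \<otimes> s [^] (0::int)" using Mc[OF \<open>h \<in> M\<close>] by simp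
      ultimately show ?thesis by blast
    qed
  next
    case (eng h1 h2)
    then obtain a b and k l :: int where ab: "a \<in> M" "b \<in> M" "h1 = a \<otimes> s [^] k" "h2 = b \<otimes> s [^] l"
      by blast
    have "h1 \<otimes> h2 = (a \<otimes> (s [^] k \<otimes> b \<otimes> s [^] (-k))) \<otimes> s [^] (k + l)"
    proof -
      have "s [^] (k + l) = s [^] k \<otimes> s [^] l" using s by (simp add: int_pow_mult)
      moreover have "inv (s [^] k) \<otimes> (s [^] k \<otimes> s [^] l) = s [^] l"
        using s by (simp flip: m_assoc)
      ultimately show ?thesis
        using s ab Mc[OF ab(1)] Mc[OF ab(2)] by (simp add: int_pow_neg m_assoc)
    qed
    moreover have "a \<otimes> (s [^] k \<otimes> b \<otimes> s [^] (-k)) \<in> M"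
      using ab nrmk subgroup.m_closed[OF M] by blast
    ultimately show ?case by blast
  qed
  then obtain a and k :: int where a: "a \<in> M" "x = a \<otimes> s [^] k" by blast
  let ?e = "nat (k mod int m)"
  have k: "k = int m * (k div int m) + int ?e" using m by simp
  have "s [^] k = (s [^] m) [^] (k div int m) \<otimes> s [^] ?e"
    using s by (subst k) (simp add: int_pow_mult int_pow_pow flip: int_pow_int)
  moreover have "(s [^] m) [^] (k div int m) \<in> M" using m M subgroup_int_pow_closed by blast
  ultimately have "x = (a \<otimes> (s [^] m) [^] (k div int m)) \<otimes> s [^] ?e"
      "a \<otimes> (s [^] m) [^] (k div int m) \<in> M"
    using a s Mc subgroup.m_closed[OF M] by (simp_all add: m_assoc)
  moreover have "?e < m" using m by (simp add: nat_less_iff)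
  ultimately show ?thesis by blast
qed

text \<open>The commutator hypothesis makes M normal in K with abelian quotient, so adjoining one s
  multiplies the number of cosets by at most m. M is arbitrary in the induction: the group generated
  by M and s takes its place and inherits every hypothesis.\<close>

lemma finitely_covered_generate_Un:
  assumes "finite S" and "subgroup K G" and "S \<subseteq> K"
    and "subgroup M G" and "M \<subseteq> K"
    and "\<And>x y. x \<in> K \<Longrightarrow> y \<in> K \<Longrightarrow> x \<otimes> y \<otimes> inv x \<otimes> inv y \<in> M"
    and "\<And>s. s \<in> S \<Longrightarrow> \<exists>m::nat. m > 0 \<and> s [^] m \<in> M"
  shows "finitely_covered G (generate G (M \<union> S)) M"
  using assms
proof (induction S arbitrary: M rule: finite_induct)
  case empty
  have "generate G M = M" using empty.prems generate_incl generate_subgroup_incl[of M M]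
    by (metis generate.incl order_refl subsetI subset_antisym)
  moreover have "x = x \<otimes> \<one>" if "x \<in> M" for x
    using subgroup.mem_carrier[OF empty.prems(3) that] by simp
  ultimately show ?case using subgroup.one_closed[OF empty.prems(3)]
    unfolding finitely_covered_def by (intro exI[of _ "{\<one>}"]) auto
next
  case (insert s S)
  note K = insert.prems(1) and M = insert.prems(3)
  note Kc = subgroup.mem_carrier[OF K] and Mc = subgroup.mem_carrier[OF M]
  have sK: "s \<in> K" "s \<in> carrier G" using insert.prems Kc by auto
  have nrm: "g \<otimes> a \<otimes> inv g \<in> M" if "g \<in> K" "a \<in> M" for g a
  proof -
    have "(g \<otimes> a \<otimes> inv g \<otimes> inv a) \<otimes> a \<in> M"
      using insert.prems that subgroup.m_closed[OF M] by blast
    then show ?thesis using that Kc Mc by (simp add: m_assoc)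
  qed
  obtain m :: nat where m: "m > 0" "s [^] m \<in> M" using insert.prems by blast
  let ?M1 = "generate G (insert s M)"
  have sub: "insert s M \<subseteq> carrier G" using sK Mc by blast
  have M1: "subgroup ?M1 G" using generate_is_subgroup[OF sub] .
  have MM1: "M \<subseteq> ?M1" by (auto intro: generate.incl)
  have M1K: "?M1 \<subseteq> K" using generate_subgroup_incl[OF _ K] insert.prems by blast
  have cov: "\<exists>e<m. \<exists>a\<in>M. x = a \<otimes> s [^] e" if "x \<in> ?M1" for x
  proof (rule generate_insert_cover[OF M sK(2) _ _ m that])
    fix a assume "a \<in> M"
    then show "s \<otimes> a \<otimes> inv s \<in> M" using nrm sK by blast
    show "inv s \<otimes> a \<otimes> s \<in> M"
      using nrm[of "inv s" a] sK \<open>a \<in> M\<close> subgroup.m_inv_closed[OF K] by simp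
  qed
  have "finitely_covered G (generate G (?M1 \<union> S)) ?M1"
  proof (rule insert.IH[OF K _ M1 M1K])
    show "S \<subseteq> K" using insert.prems(2) by blast
    show "x \<otimes> y \<otimes> inv x \<otimes> inv y \<in> ?M1" if "x \<in> K" "y \<in> K" for x y
      using insert.prems(5)[OF that] MM1 by blast
    show "\<exists>m::nat. m > 0 \<and> t [^] m \<in> ?M1" if "t \<in> S" for t
      using insert.prems(6)[of t] that MM1 by blast
  qed
  then obtain R where R: "finite R" "R \<subseteq> generate G (?M1 \<union> S)"
      "\<forall>x\<in>generate G (?M1 \<union> S). \<exists>r\<in>R. \<exists>y\<in>?M1. x = y \<otimes> r"
    unfolding finitely_covered_def by blast
  let ?Y = "generate G (M \<union> insert s S)"
  have YC: "M \<union> insert s S \<subseteq> carrier G" using insert.prems Kc Mc by blast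
  have Y: "subgroup ?Y G" using generate_is_subgroup[OF YC] .
  have M1Y: "?M1 \<subseteq> ?Y" by (rule mono_generate) blast
  have eq: "generate G (?M1 \<union> S) = ?Y"
  proof
    show "generate G (?M1 \<union> S) \<subseteq> ?Y"
      by (rule generate_subgroup_incl[OF _ Y]) (use M1Y in \<open>auto intro: generate.incl\<close>)
    show "?Y \<subseteq> generate G (?M1 \<union> S)"
      by (rule mono_generate) (auto intro: generate.incl)
  qed
  \<comment> \<open>The coset of \<open>?M1\<close> through r is covered by the cosets of M through
    s^e r with e < m.\<close>
  let ?R = "(\<lambda>(e, r). s [^] e \<otimes> r) ` ({..<m} \<times> R)"
  have "finite ?R" using R by simp
  moreover have "?R \<subseteq> ?Y"
  proof clarify
    fix e r assume "r \<in> R"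
    then have "r \<in> ?Y" using R eq by blast
    moreover have "s \<in> ?Y" by (auto intro: generate.incl)
    then have "s [^] (int e) \<in> ?Y" using Y subgroup_int_pow_closed by blast
    ultimately show "s [^] (e::nat) \<otimes> r \<in> ?Y"
      using subgroup.m_closed[OF Y] by (simp add: int_pow_int)
  qed
  moreover have "\<forall>x\<in>?Y. \<exists>r\<in>?R. \<exists>a\<in>M. x = a \<otimes> r"
  proof
    fix x assume "x \<in> ?Y"
    then obtain r y where r: "r \<in> R" "y \<in> ?M1" "x = y \<otimes> r"
      using R(3) unfolding eq by blast
    then obtain e a where e: "e < m" "a \<in> M" "y = a \<otimes> s [^] e"
      using cov by blast
    have "r \<in> carrier G" using r R eq subgroup.mem_carrier[OF Y] by blast
    then have "x = a \<otimes> (s [^] e \<otimes> r)" using r e sK Mc by (simp add: m_assoc)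
    moreover have "s [^] e \<otimes> r \<in> ?R" using e r by force
    ultimately show "\<exists>r\<in>?R. \<exists>a\<in>M. x = a \<otimes> r" using e by blast
  qed
  ultimately show ?case unfolding finitely_covered_def by blast
qed

lemma finitely_covered_trans:
  assumes "finitely_covered G K M" "finitely_covered G M N"
    and K: "subgroup K G" and "M \<subseteq> K" "N \<subseteq> M"
  shows "finitely_covered G K N"
proof -
  obtain R where R: "finite R" "R \<subseteq> K" "\<forall>x\<in>K. \<exists>r\<in>R. \<exists>y\<in>M. x = y \<otimes> r"
    using assms unfolding finitely_covered_def by blast
  obtain T where T: "finite T" "T \<subseteq> M" "\<forall>x\<in>M. \<exists>r\<in>T. \<exists>y\<in>N. x = y \<otimes> r"
    using assms unfolding finitely_covered_def by blast
  let ?R = "(\<lambda>(t, r). t \<otimes> r) ` (T \<times> R)"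
  have "finite ?R" using R T by simp
  moreover have "t \<otimes> r \<in> K" if "t \<in> T" "r \<in> R" for t r
    using that R(2) T(2) \<open>M \<subseteq> K\<close> subgroup.m_closed[OF K, of t r] by blast
  then have "?R \<subseteq> K" by auto
  moreover have "\<forall>x\<in>K. \<exists>r\<in>?R. \<exists>y\<in>N. x = y \<otimes> r"
  proof
    fix x assume "x \<in> K"
    then obtain r y where r: "r \<in> R" "y \<in> M" "x = y \<otimes> r" using R by blast
    then obtain t a where t: "t \<in> T" "a \<in> N" "y = a \<otimes> t" using T by blast
    have "x = a \<otimes> (t \<otimes> r)" using r t R T assms subgroup.mem_carrier[OF K]
      by (metis m_assoc subset_iff)
    moreover have "t \<otimes> r \<in> ?R" using t r by force
    ultimately show "\<exists>r\<in>?R. \<exists>y\<in>N. x = y \<otimes> r" using t by blast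
  qed
  ultimately show ?thesis unfolding finitely_covered_def by blast
qed

text \<open>Schreier's argument: with r s = \<open>\<mu> r s\<close> times \<open>\<rho> r s\<close>
  for representatives r and generators s, pushing the representative through a word leaves behind a
  product of factors in M.\<close>

lemma schreier_finitely_generated:
  assumes S: "finite S" "S \<subseteq> carrier G" and K: "K = generate G S"
    and M: "subgroup M G" "M \<subseteq> K" and fc: "finitely_covered G K M"
  shows "\<exists>T. finite T \<and> T \<subseteq> M \<and> generate G T = M"
proof -
  have Ks: "subgroup K G" using generate_is_subgroup[OF S(2)] K by simp
  note Kc = subgroup.mem_carrier[OF Ks] and Mc = subgroup.mem_carrier[OF M(1)]
  obtain R0 where R0: "finite R0" "R0 \<subseteq> K" "\<forall>x\<in>K. \<exists>r\<in>R0. \<exists>y\<in>M. x = y \<otimes> r"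
    using fc unfolding finitely_covered_def by blast
  let ?R = "insert \<one> R0" and ?S = "S \<union> m_inv G ` S"
  have RK: "?R \<subseteq> K" using R0 subgroup.one_closed[OF Ks] by blast
  have SK: "?S \<subseteq> K" unfolding K by (auto intro: generate.incl generate.inv)
  have "\<exists>r'\<in>?R. \<exists>m\<in>M. r \<otimes> s = m \<otimes> r'" if "r \<in> ?R" "s \<in> ?S" for r s
  proof -
    have "r \<otimes> s \<in> K" using that RK SK subgroup.m_closed[OF Ks] by blast
    then show ?thesis using R0 by blast
  qed
  then obtain \<rho> \<mu> where \<rho>\<mu>: "\<And>r s. r \<in> ?R \<Longrightarrow> s \<in> ?S \<Longrightarrow>
      \<rho> r s \<in> ?R \<and> \<mu> r s \<in> M \<and> r \<otimes> s = \<mu> r s \<otimes> \<rho> r s"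
    by metis
  \<comment> \<open>The representatives need not form a transversal, so for an element of M the walk
    may end at some r other than \<one>. That r then lies in M, which is why such r are counted
    among the generators.\<close>
  let ?T = "(\<lambda>(r, s). \<mu> r s) ` (?R \<times> ?S) \<union> (?R \<inter> M)"
  have T: "finite ?T" "?T \<subseteq> M" using R0 S \<rho>\<mu> by auto
  have TM: "generate G ?T \<subseteq> M" by (rule generate_subgroup_incl[OF T(2) M(1)])
  have Ts: "subgroup (generate G ?T) G" using T Mc by (intro generate_is_subgroup) blast
  note Tc = subgroup.mem_carrier[OF Ts]
  let ?Q = "\<lambda>x. \<exists>t\<in>generate G ?T. \<exists>r\<in>?R. x = t \<otimes> r"
  have step: "?Q (x \<otimes> s)" if "?Q x" "s \<in> ?S" for x s
  proof -
    obtain t r where tr: "t \<in> generate G ?T" "r \<in> ?R" "x = t \<otimes> r" using \<open>?Q x\<close> by blast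
    have "\<mu> r s \<in> generate G ?T" using tr that by (intro generate.incl) auto
    then have "t \<otimes> \<mu> r s \<in> generate G ?T" using tr subgroup.m_closed[OF Ts] by blast
    moreover have "x \<otimes> s = (t \<otimes> \<mu> r s) \<otimes> \<rho> r s"
    proof -
      have "r \<in> carrier G" "s \<in> carrier G" "\<rho> r s \<in> carrier G" "\<mu> r s \<in> carrier G" "t \<in> carrier G"
        using tr that \<rho>\<mu>[of r s] RK SK Kc Mc Tc by blast+
      then show ?thesis using \<rho>\<mu>[of r s] tr that by (simp add: m_assoc)
    qed
    ultimately show ?thesis using \<rho>\<mu>[of r s] tr that by blast
  qed
  \<comment> \<open>The start x stays arbitrary because for a product of h1 and h2 the second factor
    is applied to x h1.\<close>
  have mult: "?Q (x \<otimes> k)" if "k \<in> generate G S" "?Q x" "x \<in> carrier G" for x k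
    using that
  proof (induction arbitrary: x)
    case one then show ?case by simp
  next
    case (incl h) then show ?case using step by blast
  next
    case (inv h) then show ?case using step by blast
  next
    case (eng h1 h2)
    have c: "h1 \<in> carrier G" "h2 \<in> carrier G" using eng generate_in_carrier[OF S(2)] by blast+
    then have "?Q ((x \<otimes> h1) \<otimes> h2)" using eng by simp
    then show ?case using c eng by (simp add: m_assoc)
  qed
  have "M \<subseteq> generate G ?T"
  proof
    fix x assume x: "x \<in> M"
    have "?Q \<one>" using subgroup.one_closed[OF Ts] by force
    then have "?Q (\<one> \<otimes> x)" using mult[of x \<one>] x M K by blast
    then have "?Q x" using Mc[OF x] by simp
    then obtain t r where tr: "t \<in> generate G ?T" "r \<in> ?R" "x = t \<otimes> r" by blast
    have "r = inv t \<otimes> x" using tr RK Kc Tc by (simp add: inv_solve_left subset_iff)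
      (metis insert_iff inv_solve_left m_closed one_closed r_one)
    moreover have "inv t \<otimes> x \<in> M"
      using tr TM x subgroup.m_closed[OF M(1)] subgroup.m_inv_closed[OF M(1)] by blast
    ultimately have "r \<in> generate G ?T" using tr by (intro generate.incl) auto
    then show "x \<in> generate G ?T" using tr subgroup.m_closed[OF Ts] by blast
  qed
  then show ?thesis using T TM by blast
qed

section \<open>The chain of products of H with the lower central series\<close>

lemma lower_central_descending:
  "subgroup (lower_central G n) G \<and> lower_central G (Suc n) \<subseteq> lower_central G n"
proof (induction n)
  case 0
  have "{x \<otimes> y \<otimes> inv x \<otimes> inv y |x y. x \<in> carrier G \<and> y \<in> carrier G} \<subseteq> carrier G" by auto
  then show ?case using generate_incl subgroup_self by simp
next
  case (Suc n)
  let ?Y = "\<lambda>N. {x \<otimes> y \<otimes> inv x \<otimes> inv y |x y. x \<in> carrier G \<and> y \<in> N}"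
  have "?Y (lower_central G n) \<subseteq> carrier G" using subgroup.mem_carrier Suc by fastforce
  then have "subgroup (lower_central G (Suc n)) G" using generate_is_subgroup by simp
  moreover have "?Y (lower_central G (Suc n)) \<subseteq> ?Y (lower_central G n)" using Suc by blast
  then have "lower_central G (Suc (Suc n)) \<subseteq> lower_central G (Suc n)"
    by (simp add: mono_generate)
  ultimately show ?case by blast
qed

lemma lower_central_commutator:
  assumes "x \<in> carrier G" "y \<in> lower_central G n"
  shows "x \<otimes> y \<otimes> inv x \<otimes> inv y \<in> lower_central G (Suc n)"
  using assms by (auto intro: generate.incl)

lemma lower_central_normal: "lower_central G n \<lhd> G"
proof (rule normal_invI)
  have N: "subgroup (lower_central G n) G" "lower_central G (Suc n) \<subseteq> lower_central G n"
    using lower_central_descending by blast+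
  show "subgroup (lower_central G n) G" by (rule N)
  fix x h assume x: "x \<in> carrier G" and h: "h \<in> lower_central G n"
  have "(x \<otimes> h \<otimes> inv x \<otimes> inv h) \<otimes> h \<in> lower_central G n"
    using lower_central_commutator[OF x h] N h subgroup.m_closed[OF N(1)] by blast
  then show "x \<otimes> h \<otimes> inv x \<in> lower_central G n"
    using x subgroup.mem_carrier[OF N(1) h] by (simp add: m_assoc)
qed

text \<open>Modulo \<open>lower_central G (Suc n)\<close> the elements of \<open>lower_central G n\<close> are central, so
  commutators in \<open>H \<cdot> lower_central G n\<close> reduce to commutators in \<open>H\<close>.\<close>

lemma commutator_in_set_mult_lower_central:
  assumes H: "subgroup H G"
    and x: "x \<in> H <#> lower_central G n" and y: "y \<in> H <#> lower_central G n"
  shows "x \<otimes> y \<otimes> inv x \<otimes> inv y \<in> H <#> lower_central G (Suc n)"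
proof -
  define N where "N = lower_central G (Suc n)"
  let ?C = "\<lambda>x y. x \<otimes> y \<otimes> inv x \<otimes> inv y"
  obtain h z where hz: "h \<in> H" "z \<in> lower_central G n" "x = h \<otimes> z"
    using x unfolding set_mult_def by blast
  obtain k w where kw: "k \<in> H" "w \<in> lower_central G n" "y = k \<otimes> w"
    using y unfolding set_mult_def by blast
  note Nc = subgroup.mem_carrier[OF conjunct1[OF lower_central_descending]]
  have c: "h \<in> carrier G" "z \<in> carrier G" "k \<in> carrier G" "w \<in> carrier G"
    by (fact subgroup.mem_carrier[OF H hz(1)] Nc[OF hz(2)]
        subgroup.mem_carrier[OF H kw(1)] Nc[OF kw(2)])+
  interpret N: normal N G unfolding N_def by (rule lower_central_normal)
  have yc: "y \<in> carrier G" using c kw(3) by simp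
  have "?C z y = inv (?C y z)" using c(2) yc by (simp add: inv_mult_group m_assoc)
  moreover have "?C y z \<in> N" unfolding N_def by (rule lower_central_commutator[OF yc hz(2)])
  ultimately have 1: "?C z y \<in> N" using N.m_inv_closed by metis
  have 2: "?C h w \<in> N" unfolding N_def by (rule lower_central_commutator[OF c(1) kw(2)])
  \<comment> \<open>Combines [h z, y] = h [z, y] h^-1 [h, y] with [h, k w] = [h, k] k [h, w] k^-1.
    Moving [h, k] to the front then conjugates the first factor, which stays in N by
    normality.\<close>
  have "?C x y = (h \<otimes> ?C z y \<otimes> inv h) \<otimes> (?C h k \<otimes> (k \<otimes> ?C h w \<otimes> inv k))"
    unfolding hz(3) kw(3) using c by (simp add: inv_mult_group m_assoc inv_cancel_left)
  also have "\<dots> = ?C h k \<otimes> ((inv (?C h k) \<otimes> (h \<otimes> ?C z y \<otimes> inv h) \<otimes> ?C h k) \<otimes> (k \<otimes> ?C h w \<otimes> inv k))"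
  proof -
    have swap: "u \<otimes> (v \<otimes> t) = v \<otimes> ((inv v \<otimes> u \<otimes> v) \<otimes> t)"
      if "u \<in> carrier G" "v \<in> carrier G" "t \<in> carrier G" for u v t
      using that by (simp add: m_assoc inv_cancel_left)
    show ?thesis by (rule swap) (use c yc in simp_all)
  qed
  finally have "?C x y = ?C h k \<otimes> ((inv (?C h k) \<otimes> (h \<otimes> ?C z y \<otimes> inv h) \<otimes> ?C h k) \<otimes> (k \<otimes> ?C h w \<otimes> inv k))" .
  moreover have "?C h k \<in> H"
    using hz kw by (intro subgroup.m_closed[OF H] subgroup.m_inv_closed[OF H])
  moreover have "(inv (?C h k) \<otimes> (h \<otimes> ?C z y \<otimes> inv h) \<otimes> ?C h k) \<otimes> (k \<otimes> ?C h w \<otimes> inv k) \<in> N"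
    by (intro N.m_closed[OF N.inv_op_closed1[OF _ N.inv_op_closed2[OF c(1) 1]] N.inv_op_closed2[OF c(3) 2]])
      (use c in simp)
  ultimately show ?thesis unfolding set_mult_def N_def[symmetric] by blast
qed

text \<open>The groups \<open>?K n\<close> descend from G to H. Each quotient of consecutive ones is
  abelian and generated by finitely many elements of finite order, as every element has a power in
  H, so it is finite. Finite generation has to travel along in the induction; Schreier's argument
  supplies it at each stage.\<close>

theorem finite_index_if_power_dense:
  assumes fg: "finitely_generated G" and nil: "nilpotent_group G" and pd: "power_dense H G"
  shows "finite_index H G"
proof -
  have H: "subgroup H G" using pd by (simp add: power_dense_def)
  let ?K = "\<lambda>n. H <#> lower_central G n"
  have Ks: "subgroup (?K n) G" for n
    using mult_norm_subgroup[OF lower_central_normal H] commut_normal[OF H lower_central_normal]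
    by metis
  have HK: "H \<subseteq> ?K n" for n
    using subgroup.one_closed[of "lower_central G n" G] lower_central_descending
      subgroup.mem_carrier[OF H] unfolding set_mult_def by force
  have KS: "?K (Suc n) \<subseteq> ?K n" for n
    using lower_central_descending[of n] unfolding set_mult_def by blast
  have "x \<in> ?K 0" if "x \<in> carrier G" for x
    using subgroup.one_closed[OF H] l_one[OF that] that
    unfolding set_mult_def lower_central.simps by blast
  then have K0: "?K 0 = carrier G" using subgroup.subset[OF Ks[of 0]] by blast
  have "finitely_covered G (carrier G) (?K n) \<and> (\<exists>S. finite S \<and> S \<subseteq> carrier G \<and> ?K n = generate G S)" for n
  proof (induction n)
    case 0
    have "finitely_covered G (carrier G) (carrier G)" unfolding finitely_covered_def
      by (intro exI[of _ "{\<one>}"]) (auto simp: coset_mult_one)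
    then show ?case using fg K0 unfolding finitely_generated_def by metis
  next
    case (Suc n)
    then obtain S where S: "finite S" "S \<subseteq> carrier G" "?K n = generate G S" by blast
    have SK: "S \<subseteq> ?K n" unfolding S(3) by (auto intro: generate.incl)
    have "finitely_covered G (generate G (?K (Suc n) \<union> S)) (?K (Suc n))"
    proof (rule finitely_covered_generate_Un[OF S(1) Ks[of n] SK Ks KS])
      show "x \<otimes> y \<otimes> inv x \<otimes> inv y \<in> ?K (Suc n)" if "x \<in> ?K n" "y \<in> ?K n" for x y
        using commutator_in_set_mult_lower_central[OF H that] .
      show "\<exists>m::nat. m > 0 \<and> s [^] m \<in> ?K (Suc n)" if "s \<in> S" for s
        using pd that S HK unfolding power_dense_def by blast
    qed
    moreover have "generate G (?K (Suc n) \<union> S) = ?K n"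
    proof
      show "generate G (?K (Suc n) \<union> S) \<subseteq> ?K n"
        using generate_subgroup_incl[OF _ Ks] KS SK by blast
      show "?K n \<subseteq> generate G (?K (Suc n) \<union> S)"
        unfolding S(3) by (rule mono_generate) blast
    qed
    ultimately have fc: "finitely_covered G (?K n) (?K (Suc n))" by metis
    then have "finitely_covered G (carrier G) (?K (Suc n))"
      using finitely_covered_trans[OF _ fc subgroup_self subgroup.subset[OF Ks] KS] Suc by blast
    moreover have "\<exists>T. finite T \<and> T \<subseteq> ?K (Suc n) \<and> generate G T = ?K (Suc n)"
      using schreier_finitely_generated[OF S Ks KS fc] .
    then have "\<exists>S. finite S \<and> S \<subseteq> carrier G \<and> ?K (Suc n) = generate G S"
      using subgroup.subset[OF Ks] by blast
    ultimately show ?case by blast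
  qed
  moreover obtain n where "lower_central G n = {\<one>}"
    using nil unfolding nilpotent_group_def by blast
  then have "?K n = H" using subgroup.mem_carrier[OF H] unfolding set_mult_def by force
  ultimately show ?thesis using finite_index_if_finitely_covered[OF H] by metis
qed

end

section \<open>Rational nilpotent Lie algebras\<close>

lemma rat_ring_simps [simp]:
  "carrier rat_ring = UNIV" "a \<otimes>\<^bsub>rat_ring\<^esub> b = a * b" "\<one>\<^bsub>rat_ring\<^esub> = 1"
  "\<zero>\<^bsub>rat_ring\<^esub> = 0" "a \<oplus>\<^bsub>rat_ring\<^esub> b = a + b"
  by (simp_all add: ring_of_type_algebra_def)

definition ad_word :: "('r, 'm, 'c) lie_alg_scheme \<Rightarrow> ('x \<Rightarrow> 'm) \<Rightarrow> 'x list \<Rightarrow> 'm \<Rightarrow> 'm" where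
  "ad_word L g u v = foldr (\<lambda>a. bracket L (g a)) u v"

text \<open>The noncommutative polynomial with coefficients k on the words in U, evaluated at the
  operators ad (g a) and applied to v.\<close>

definition ad_sum ::
  "('r, 'm, 'c) lie_alg_scheme \<Rightarrow> ('x list \<Rightarrow> 'r) \<Rightarrow> ('x \<Rightarrow> 'm) \<Rightarrow> 'x list set \<Rightarrow> 'm \<Rightarrow> 'm" where
  "ad_sum L k g U v = finsum L (\<lambda>u. k u \<odot>\<^bsub>L\<^esub> ad_word L g u v) U"

lemma ad_word_simps [simp]:
  "ad_word L g [] v = v"
  "ad_word L g (a # u) v = bracket L (g a) (ad_word L g u v)"
  by (simp_all add: ad_word_def)

lemma ad_word_map: "ad_word L g (map h u) v = ad_word L (g \<circ> h) u v"
  by (induction u) simp_all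

text \<open>Exposes the innermost bracket, so that every term of degree at least 2 in the series
  becomes an operator applied to a bracket of two variables.\<close>

lemma right_normed_append2:
  "right_normed L (map g (u @ [a, b])) = ad_word L g u (bracket L (g a) (g b))"
proof (induction u)
  case (Cons c u)
  then show ?case by (cases u) auto
qed simp

locale rational_lie_algebra = lie_algebra rat_ring L
  for L :: "(rat, 'm, 'c) lie_alg_scheme" (structure)
begin

abbreviation \<gamma> :: "nat \<Rightarrow> 'm set" where "\<gamma> \<equiv> lie_lower_central rat_ring L"

section \<open>Scalars, brackets and the lower central series of L\<close>

lemma smult_in [simp, intro]: "x \<in> carrier L \<Longrightarrow> q \<odot> x \<in> carrier L"
  using smult_closed[of q x] by simp

lemma smult_smult: "x \<in> carrier L \<Longrightarrow> a \<odot> (b \<odot> x) = (a * b) \<odot> x"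
  using smult_assoc1[of a b x] by simp

lemma smult_1 [simp]: "x \<in> carrier L \<Longrightarrow> 1 \<odot> x = x"
  using smult_one[of x] by simp

lemma smult_0 [simp]: "x \<in> carrier L \<Longrightarrow> 0 \<odot> x = \<zero>"
  using smult_l_null[of x] by simp

lemma smult_zero [simp]: "q \<odot> \<zero> = \<zero>"
  using smult_r_null[of q] by simp

lemma smult_add_left: "x \<in> carrier L \<Longrightarrow> (a + b) \<odot> x = a \<odot> x \<oplus> b \<odot> x"
  using smult_l_distr[of a b x] by simp

lemma smult_add_right: "x \<in> carrier L \<Longrightarrow> y \<in> carrier L \<Longrightarrow> q \<odot> (x \<oplus> y) = q \<odot> x \<oplus> q \<odot> y"
  using smult_r_distr[of q x y] by simp

lemma smult_minus_1: "x \<in> carrier L \<Longrightarrow> (- 1) \<odot> x = \<ominus> x"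
  using smult_add_left[of x "-1" 1] M.minus_equality[of "(-1) \<odot> x" x] by simp

lemma smult_cancel:
  assumes "q \<noteq> 0" "x \<in> carrier L" "y \<in> carrier L" "q \<odot> x = q \<odot> y"
  shows "x = y"
proof -
  have "inverse q \<odot> (q \<odot> x) = inverse q \<odot> (q \<odot> y)" using assms by simp
  then have "(inverse q * q) \<odot> x = (inverse q * q) \<odot> y" using assms(2,3) by (simp only: smult_smult)
  then show ?thesis using assms(1-3) by simp
qed

lemma bracket_in [simp, intro]: "x \<in> carrier L \<Longrightarrow> y \<in> carrier L \<Longrightarrow> bracket L x y \<in> carrier L"
  by (rule bracket_closed)

lemma bracket_zero_right [simp]: "x \<in> carrier L \<Longrightarrow> bracket L x \<zero> = \<zero>"
  using bracket_smult_right[of 0 x \<zero>] by simp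

lemma bracket_commute:
  assumes "x \<in> carrier L" "y \<in> carrier L"
  shows "bracket L y x = \<ominus> bracket L x y"
proof -
  have "bracket L (x \<oplus> y) (x \<oplus> y) = bracket L y x \<oplus> bracket L x y"
    using assms bracket_self[of x] bracket_self[of y]
    by (simp add: bracket_add_left bracket_add_right)
  then have "bracket L y x \<oplus> bracket L x y = \<zero>"
    using bracket_self[of "x \<oplus> y"] assms by simp
  then show ?thesis using M.minus_equality[of "bracket L y x" "bracket L x y"] assms by simp
qed

text \<open>The hull is an intersection, and it stays inside the carrier because
  \<open>carrier L\<close> is one of the submodules intersected. This requires all the brackets to
  lie in the carrier, which is shown beforehand.\<close>

lemma submodule_\<gamma>: "submodule (\<gamma> n) rat_ring L"
proof (cases n)
  case 0
  then show ?thesis using carrier_is_submodule by simp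
next
  case (Suc m)
  let ?X = "{bracket L x y | x y. x \<in> carrier L \<and> y \<in> \<gamma> m}"
  have "\<gamma> m \<subseteq> carrier L"
  proof (induction m)
    case (Suc j)
    then have "{bracket L x y | x y. x \<in> carrier L \<and> y \<in> \<gamma> j} \<subseteq> carrier L" by auto
    then show ?case
      using hull_minimal[where S = "\<lambda>N. submodule N rat_ring L", OF _ carrier_is_submodule] by simp
  qed simp
  then have "bracket L x y \<in> carrier L" if "x \<in> carrier L" "y \<in> \<gamma> m" for x y
    using that by (meson bracket_in subsetD)
  then have "?X \<subseteq> carrier L" by blast
  then have sub: "\<gamma> n \<subseteq> carrier L" unfolding Suc lie_lower_central.simps
    by (rule hull_minimal) (rule carrier_is_submodule)
  have mem: "a \<in> \<gamma> n \<longleftrightarrow> (\<forall>N. submodule N rat_ring L \<longrightarrow> ?X \<subseteq> N \<longrightarrow> a \<in> N)" for a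
    using Suc by (auto simp: hull_def)
  show ?thesis
  proof (rule submoduleI[OF sub])
    show "\<zero> \<in> \<gamma> n" unfolding mem
      using subgroup.one_closed[OF submodule.axioms(1)] by fastforce
    show "\<ominus> a \<in> \<gamma> n" if "a \<in> \<gamma> n" for a using that submoduleE(3) unfolding mem by blast
    show "a \<oplus> b \<in> \<gamma> n" if "a \<in> \<gamma> n" "b \<in> \<gamma> n" for a b
      using that submoduleE(5) unfolding mem by blast
    show "a \<odot> x \<in> \<gamma> n" if "a \<in> carrier rat_ring" "x \<in> \<gamma> n" for a x
      using that submoduleE(4) unfolding mem by blast
  qed
qed

lemma \<gamma>_carrier: "v \<in> \<gamma> n \<Longrightarrow> v \<in> carrier L"
  using submoduleE(1)[OF submodule_\<gamma>] by blast

lemma \<gamma>_zero: "\<zero> \<in> \<gamma> n"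
  using subgroup.one_closed[OF submodule.axioms(1)[OF submodule_\<gamma>[of n]]] by simp

lemma \<gamma>_minus: "v \<in> \<gamma> n \<Longrightarrow> \<ominus> v \<in> \<gamma> n"
  by (rule submoduleE(3)[OF submodule_\<gamma>])

lemma \<gamma>_add: "v \<in> \<gamma> n \<Longrightarrow> w \<in> \<gamma> n \<Longrightarrow> v \<oplus> w \<in> \<gamma> n"
  by (rule submoduleE(5)[OF submodule_\<gamma>])

lemma \<gamma>_smult: "v \<in> \<gamma> n \<Longrightarrow> q \<odot> v \<in> \<gamma> n"
  using submoduleE(4)[OF submodule_\<gamma>, of q v n] by simp

lemma bracket_\<gamma>: "x \<in> carrier L \<Longrightarrow> v \<in> \<gamma> n \<Longrightarrow> bracket L x v \<in> \<gamma> (Suc n)"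
  by (auto intro!: hull_inc)

lemma \<gamma>_Suc_subset: "\<gamma> (Suc n) \<subseteq> \<gamma> n"
proof (induction n)
  case 0
  show ?case unfolding lie_lower_central.simps(1) using \<gamma>_carrier by blast
next
  case (Suc n)
  have "{bracket L x y | x y. x \<in> carrier L \<and> y \<in> \<gamma> (Suc n)} \<subseteq>
      {bracket L x y | x y. x \<in> carrier L \<and> y \<in> \<gamma> n}" using Suc by blast
  then show ?case unfolding lie_lower_central.simps(2)[of _ _ "Suc n"] lie_lower_central.simps(2)[of _ _ n]
    by (rule hull_mono)
qed

lemma \<gamma>_antimono: "m \<le> n \<Longrightarrow> \<gamma> n \<subseteq> \<gamma> m"
  by (rule lift_Suc_antimono_le) (rule \<gamma>_Suc_subset)

text \<open>Infinite U are covered too: there \<open>finsum\<close> is \<zero>, which lies in every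
  term.\<close>

lemma finsum_\<gamma>: "(\<And>u. u \<in> U \<Longrightarrow> h u \<in> \<gamma> n) \<Longrightarrow> finsum L h U \<in> \<gamma> n"
proof (induction U rule: infinite_finite_induct)
  case (insert u U)
  then have "h \<in> insert u U \<rightarrow> carrier L" using \<gamma>_carrier by blast
  then show ?case using insert by (simp add: M.finsum_insert \<gamma>_add Pi_iff)
qed (simp_all add: \<gamma>_zero M.finsum_infinite)

section \<open>Operators built from iterated brackets\<close>

lemma ad_word_\<gamma>:
  "(\<And>a. g a \<in> carrier L) \<Longrightarrow> v \<in> \<gamma> n \<Longrightarrow> ad_word L g u v \<in> \<gamma> (n + length u)"
proof (induction u)
  case (Cons a u)
  then show ?case using bracket_\<gamma> by (simp del: lie_lower_central.simps)
qed simp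

lemma ad_word_in [simp, intro]:
  "(\<And>a. g a \<in> carrier L) \<Longrightarrow> v \<in> carrier L \<Longrightarrow> ad_word L g u v \<in> carrier L"
  by (induction u) auto

lemma ad_word_add:
  "(\<And>a. g a \<in> carrier L) \<Longrightarrow> v \<in> carrier L \<Longrightarrow> w \<in> carrier L \<Longrightarrow>
   ad_word L g u (v \<oplus> w) = ad_word L g u v \<oplus> ad_word L g u w"
  by (induction u) (auto simp: bracket_add_right)

lemma ad_word_zero [simp]: "(\<And>a. g a \<in> carrier L) \<Longrightarrow> ad_word L g u \<zero> = \<zero>"
  by (induction u) auto

lemma ad_sum_\<gamma>:
  "(\<And>a. g a \<in> carrier L) \<Longrightarrow> v \<in> \<gamma> n \<Longrightarrow> ad_sum L k g U v \<in> \<gamma> n"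
  unfolding ad_sum_def
  by (intro finsum_\<gamma> \<gamma>_smult) (meson ad_word_\<gamma> \<gamma>_antimono le_add1 subsetD)

lemma ad_sum_in [simp, intro]:
  "(\<And>a. g a \<in> carrier L) \<Longrightarrow> v \<in> carrier L \<Longrightarrow> ad_sum L k g U v \<in> carrier L"
  using ad_sum_\<gamma>[of g v 0] by simp

lemma ad_sum_add:
  assumes "\<And>a. g a \<in> carrier L" "v \<in> carrier L" "w \<in> carrier L"
  shows "ad_sum L k g U (v \<oplus> w) = ad_sum L k g U v \<oplus> ad_sum L k g U w"
  unfolding ad_sum_def using assms
  by (subst M.finsum_addf[symmetric]) (auto simp: ad_word_add smult_add_right intro!: M.finsum_cong')

lemma ad_sum_minus:
  assumes "\<And>a. g a \<in> carrier L" "v \<in> carrier L"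
  shows "ad_sum L k g U (\<ominus> v) = \<ominus> ad_sum L k g U v"
proof -
  have "ad_sum L k g U (\<ominus> v) \<oplus> ad_sum L k g U v = ad_sum L k g U \<zero>"
    using assms by (simp add: M.l_neg flip: ad_sum_add)
  also have "\<dots> = \<zero>" unfolding ad_sum_def using assms by (simp add: M.finsum_zero)
  finally show ?thesis using assms by (intro M.minus_equality[symmetric]) auto
qed

text \<open>An operator \<open>1 + N\<close>, where \<open>N\<close> lowers the lower central series, is injective.\<close>

lemma ad_sum_inject:
  assumes nil: "\<gamma> N = {\<zero>}" and U: "finite U" "[] \<in> U" and k: "k [] = 1"
    and g: "\<And>a. g a \<in> carrier L" and v: "v \<in> carrier L" and w: "w \<in> carrier L"
    and eq: "ad_sum L k g U v = ad_sum L k g U w"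
  shows "v = w"
proof -
  define d where "d = v \<ominus> w"
  have d: "d \<in> carrier L" using v w by (simp add: d_def)
  have "v = w \<oplus> d" using v w by (simp add: d_def M.minus_eq M.a_lcomm M.r_neg)
  then have "ad_sum L k g U v = ad_sum L k g U w \<oplus> ad_sum L k g U d"
    using ad_sum_add[of g w d k U] g w d by (simp only:)
  moreover have "ad_sum L k g U w \<in> carrier L" using g w by (rule ad_sum_in)
  moreover have "ad_sum L k g U d \<in> carrier L" using g d by (rule ad_sum_in)
  ultimately have zero: "ad_sum L k g U d = \<zero>" using eq by simp
  define r where "r = finsum L (\<lambda>u. k u \<odot> ad_word L g u d) (U - {[]})"
  have t: "k u \<odot> ad_word L g u d \<in> carrier L" for u
    using g d by (intro smult_in ad_word_in)
  have r: "r \<in> carrier L" unfolding r_def using t by (intro M.finsum_closed) blast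
  have "ad_sum L k g (insert [] (U - {[]})) d = d \<oplus> r"
    unfolding ad_sum_def r_def using U t d k by (subst M.finsum_insert) auto
  then have "d \<oplus> r = \<zero>" using zero U by (simp add: insert_absorb)
  then have dr: "d = \<ominus> r" using M.minus_equality[of d r] d r by simp
  \<comment> \<open>The equation for d feeds on itself: r collects the nonempty words, each of which
    pushes d at least one term further down the series.\<close>
  have "d \<in> \<gamma> j" for j
  proof (induction j)
    case 0
    show ?case using d by simp
  next
    case (Suc j)
    have "ad_word L g u d \<in> \<gamma> (Suc j)" if "u \<in> U - {[]}" for u
    proof -
      have "Suc j \<le> j + length u" using that by (cases u) auto
      then show ?thesis using ad_word_\<gamma>[of g d j u] g Suc \<gamma>_antimono by blast
    qed
    then have "r \<in> \<gamma> (Suc j)" unfolding r_def by (intro finsum_\<gamma> \<gamma>_smult)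
    then show ?case using dr \<gamma>_minus by metis
  qed
  then have "d = \<zero>" using nil by blast
  then show ?thesis using \<open>v = w \<oplus> d\<close> w by simp
qed

end

section \<open>The Baker--Campbell--Hausdorff operation in terms of the bracket\<close>

text \<open>The words u x y and u y x evaluate to opposite elements since [y, x] = - [x, y], so
  their coefficients merge into one. The divisor is the length of the whole word, the Dynkin factor
  in \<open>bch\<close>.\<close>

definition bch_coeff :: "bool list \<Rightarrow> rat" where
  "bch_coeff u = (bch_series (u @ [True, False]) - bch_series (u @ [False, True]))
     / of_nat (length u + 2)"

lemma bch_series_values:
  "bch_series [True] = 1" "bch_series [False] = 1"
  "bch_series [True, False] = 1/2" "bch_series [False, True] = -1/2"
  by (simp_all add: bch_series_def nc_log_def nc_mult_def nc_exp_def nc_var_def nc_one_def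
      numeral_2_eq_2 atMost_Suc)

text \<open>The classical term [x, y] / 2. Doubled by exchanging x and y, it becomes the leading 1
  that \<open>ad_sum_inject\<close> asks for.\<close>

lemma bch_coeff_Nil: "bch_coeff [] = 1/2"
  by (simp add: bch_coeff_def bch_series_values)

context rational_lie_algebra
begin

text \<open>A word whose last two letters agree contains [a, a] = 0, so beyond degree 1 only words
  ending in x y or y x contribute, and these factor through [x, y]. Prefixes u longer than N vanish
  by nilpotency.\<close>

lemma bch_eq:
  assumes nil: "\<gamma> N = {\<zero>}" and x: "x \<in> carrier L" and y: "y \<in> carrier L"
  shows "bch L x y = x \<oplus> y \<oplus>
    ad_sum L bch_coeff (\<lambda>b. if b then x else y) {u. length u \<le> N} (bracket L x y)"
proof -
  define g where "g = (\<lambda>b. if b then x else y)"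
  have g [simp]: "g a \<in> carrier L" for a using x y by (simp add: g_def)
  have gTF [simp]: "g True = x" "g False = y" by (simp_all add: g_def)
  define br where "br w = right_normed L (map g w)" for w
  define t where "t w = (bch_series w / of_nat (length w)) \<odot> br w" for w
  define U where "U = {u :: bool list. length u \<le> N}"
  have U: "finite U" unfolding U_def using finite_lists_length_le[of "UNIV :: bool set" N] by simp
  let ?xy = "\<lambda>u. u @ [True, False]" and ?yx = "\<lambda>u. u @ [False, True]"
  have br2: "br (u @ [a, b]) = ad_word L g u (bracket L (g a) (g b))" for u a b
    unfolding br_def by (rule right_normed_append2)
  have br_in: "br w \<in> carrier L" for w
  proof -
    consider "w = []" | a where "w = [a]" | u a b where "w = u @ [a, b]"
      by (metis append_butlast_last_id append_Cons append_assoc append_Nil)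
    then show ?thesis using br2 by cases (simp_all add: br_def)
  qed
  have t_in: "t \<in> A \<rightarrow> carrier L" for A using br_in by (auto simp: t_def)
  \<comment> \<open>W depends on N alone, unlike the set of nonzero brackets in \<open>bch\<close>.
    Adding zero terms is harmless and makes the expansions at different arguments
    comparable.\<close>
  define W where "W = {[True], [False]} \<union> (?xy ` U \<union> ?yx ` U)"
  have W: "finite W" using U by (simp add: W_def)
  have "w \<in> W" if "br w \<noteq> \<zero>" for w
  proof -
    consider "w = []" | a where "w = [a]" | u a b where "w = u @ [a, b]"
      by (metis append_butlast_last_id append_Cons append_assoc append_Nil)
    then show ?thesis
    proof cases
      case 1 then show ?thesis using that by (simp add: br_def)
    next
      case 2 then show ?thesis by (cases a) (simp_all add: W_def)
    next
      case 3
      have "a \<noteq> b"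
      proof
        assume "a = b"
        then have "br w = \<zero>" using br2[of u a a] 3 bracket_self[of "g a"] by simp
        then show False using that by blast
      qed
      moreover have "u \<in> U"
      proof (rule ccontr)
        assume "u \<notin> U"
        then have "\<gamma> (0 + length u) \<subseteq> \<gamma> N" by (intro \<gamma>_antimono) (simp add: U_def)
        moreover have "br w \<in> \<gamma> (0 + length u)" unfolding 3 br2 by (rule ad_word_\<gamma>) simp_all
        ultimately have "br w \<in> \<gamma> N" by blast
        then show False using nil that by simp
      qed
      ultimately show ?thesis using 3 by (cases a; cases b) (auto simp: W_def)
    qed
  qed
  then have "finsum L t {w. br w \<noteq> \<zero>} = finsum L t W"
    using W t_in by (intro M.add.finprod_mono_neutral_cong_left) (auto simp: t_def)
  also have "\<dots> = finsum L t {[True], [False]} \<oplus> finsum L t (?xy ` U \<union> ?yx ` U)"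
    unfolding W_def using U t_in by (intro M.finsum_Un_disjoint) auto
  also have "finsum L t {[True], [False]} = x \<oplus> y"
    using t_in[of "{[True], [False]}"] x y
    by (simp add: t_def br_def bch_series_values)
  also have "finsum L t (?xy ` U \<union> ?yx ` U) = finsum L t (?xy ` U) \<oplus> finsum L t (?yx ` U)"
    using U t_in by (intro M.finsum_Un_disjoint) auto
  also have "finsum L t (?xy ` U) = finsum L (\<lambda>u. t (?xy u)) U"
    using t_in by (intro M.finsum_reindex) (auto simp: inj_on_def)
  also have "finsum L t (?yx ` U) = finsum L (\<lambda>u. t (?yx u)) U"
    using t_in by (intro M.finsum_reindex) (auto simp: inj_on_def)
  also have "finsum L (\<lambda>u. t (?xy u)) U \<oplus> finsum L (\<lambda>u. t (?yx u)) U =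
      finsum L (\<lambda>u. t (?xy u) \<oplus> t (?yx u)) U"
    using t_in by (intro M.finsum_addf[symmetric]) auto
  also have "\<dots> = ad_sum L bch_coeff g U (bracket L x y)"
    unfolding ad_sum_def
  proof (intro M.finsum_cong' refl)
    fix u assume "u \<in> U"
    have neg: "ad_word L g u (\<ominus> v) = (-1) \<odot> ad_word L g u v" if "v \<in> carrier L" for v
    proof -
      have "ad_word L g u (\<ominus> v) \<oplus> ad_word L g u v = \<zero>"
        using that by (simp add: M.l_neg flip: ad_word_add)
      then show ?thesis using that M.minus_equality by (simp add: smult_minus_1)
    qed
    let ?v = "ad_word L g u (bracket L x y)"
    have v: "?v \<in> carrier L" using x y by simp
    have "t (?xy u) \<oplus> t (?yx u) = (bch_series (?xy u) / of_nat (length u + 2)) \<odot> ?v \<oplus>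
        (bch_series (?yx u) / of_nat (length u + 2)) \<odot> ((-1) \<odot> ?v)"
      unfolding t_def br2 using x y by (simp add: bracket_commute[OF x y] neg)
    also have "\<dots> = bch_coeff u \<odot> ?v"
      using v by (simp add: smult_smult bch_coeff_def diff_divide_distrib flip: smult_add_left)
    finally show "t (?xy u) \<oplus> t (?yx u) = bch_coeff u \<odot> ?v" .
  qed (use x y in auto)
  finally show ?thesis unfolding bch_def t_def br_def g_def U_def Let_def .
qed

text \<open>Exchanging x and y relabels words by \<open>Not\<close> and changes the sign of the
  bracket. In the difference of the two products the signs cancel, so the coefficients of u and
  \<open>map Not u\<close> add up.\<close>

lemma bch_swap_eq:
  assumes nil: "\<gamma> N = {\<zero>}" and x: "x \<in> carrier L" and y: "y \<in> carrier L"
  shows "bch L x y = bch L y x \<oplus>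
    ad_sum L (\<lambda>u. bch_coeff u + bch_coeff (map Not u)) (\<lambda>b. if b then x else y)
      {u. length u \<le> N} (bracket L x y)"
proof -
  define g where "g = (\<lambda>b. if b then x else y)"
  have g [simp]: "g a \<in> carrier L" for a using x y by (simp add: g_def)
  define U where "U = {u :: bool list. length u \<le> N}"
  define z where "z = bracket L x y"
  have z [simp]: "z \<in> carrier L" using x y by (simp add: z_def)
  have gN: "(\<lambda>b. if b then y else x) = g \<circ> Not" by (auto simp: g_def)
  have gNin: "(g \<circ> Not) a \<in> carrier L" for a by simp
  have "ad_sum L bch_coeff (g \<circ> Not) U z = finsum L (\<lambda>u. bch_coeff u \<odot> ad_word L g (map Not u) z) U"
    by (simp add: ad_sum_def ad_word_map)
  also have "\<dots> = finsum L (\<lambda>u. bch_coeff (map Not (map Not u)) \<odot> ad_word L g (map Not u) z) U"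
    by (simp add: comp_def)
  also have "\<dots> = finsum L (\<lambda>u. bch_coeff (map Not u) \<odot> ad_word L g u z) (map Not ` U)"
    by (intro M.finsum_reindex[symmetric]) (auto simp: inj_on_def inj_map_eq_map inj_def)
  also have "map Not ` U = U"
  proof -
    have "u \<in> map Not ` U" if "u \<in> U" for u
      using that by (intro image_eqI[of _ _ "map Not u"]) (simp_all add: comp_def U_def)
    then show ?thesis by (auto simp: U_def)
  qed
  also have "finsum L (\<lambda>u. bch_coeff (map Not u) \<odot> ad_word L g u z) U =
      ad_sum L (\<lambda>u. bch_coeff (map Not u)) g U z" by (simp add: ad_sum_def)
  finally have flip: "ad_sum L bch_coeff (g \<circ> Not) U z = ad_sum L (\<lambda>u. bch_coeff (map Not u)) g U z" .
  have "bch L y x = y \<oplus> x \<oplus> ad_sum L bch_coeff (g \<circ> Not) U (\<ominus> z)"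
    using bch_eq[OF nil y x] unfolding gN U_def z_def bracket_commute[OF x y] .
  also have "\<dots> = x \<oplus> y \<oplus> \<ominus> ad_sum L (\<lambda>u. bch_coeff (map Not u)) g U z"
    unfolding ad_sum_minus[OF gNin z] flip using x y by (simp add: M.a_comm)
  finally have yx: "bch L y x = x \<oplus> y \<oplus> \<ominus> ad_sum L (\<lambda>u. bch_coeff (map Not u)) g U z" .
  have "ad_sum L (\<lambda>u. bch_coeff u + bch_coeff (map Not u)) g U z =
      ad_sum L bch_coeff g U z \<oplus> ad_sum L (\<lambda>u. bch_coeff (map Not u)) g U z"
    unfolding ad_sum_def
    by (subst M.finsum_addf[symmetric]) (auto simp: smult_add_left intro!: M.finsum_cong')
  moreover have xy: "bch L x y = x \<oplus> y \<oplus> ad_sum L bch_coeff g U z"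
    using bch_eq[OF nil x y] unfolding g_def U_def z_def .
  moreover have *: "a \<oplus> b = a \<oplus> \<ominus> c \<oplus> (b \<oplus> c)"
    if "a \<in> carrier L" "b \<in> carrier L" "c \<in> carrier L" for a b c
  proof -
    have "a \<oplus> \<ominus> c \<oplus> (b \<oplus> c) = a \<oplus> (\<ominus> c \<oplus> (c \<oplus> b))"
      using that by (simp only: M.a_assoc M.a_comm[of b c] M.a_inv_closed M.a_closed)
    then show ?thesis using that by (simp only: M.r_neg1)
  qed
  ultimately show ?thesis
    unfolding g_def[symmetric] U_def[symmetric] z_def[symmetric] xy yx
    using *[OF M.a_closed[OF x y] ad_sum_in[of g z bch_coeff U]
        ad_sum_in[of g z "\<lambda>u. bch_coeff (map Not u)" U]] g z by metis
qed

text \<open>Descending induction along the lower central series recovers sum and bracket from the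
  Baker--Campbell--Hausdorff operation; by homogeneity it suffices to know the latter on a set
  that contains a multiple of every element.\<close>

theorem lie_hom_if_bch_hom:
  assumes nil: "\<gamma> N = {\<zero>}"
    and f: "\<And>x. x \<in> carrier L \<Longrightarrow> f x \<in> carrier L"
    and homog: "\<And>q x. x \<in> carrier L \<Longrightarrow> f (q \<odot> x) = q \<odot> f x"
    and H: "\<And>x. x \<in> carrier L \<Longrightarrow> \<exists>n::nat. n > 0 \<and> of_nat n \<odot> x \<in> H"
      "\<And>x n. x \<in> H \<Longrightarrow> of_nat n \<odot> x \<in> H"
    and bch: "\<And>x y. x \<in> H \<Longrightarrow> y \<in> H \<Longrightarrow> f (bch L x y) = bch L (f x) (f y)"
    and x: "x \<in> carrier L" and y: "y \<in> carrier L"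
  shows "f (x \<oplus> y) = f x \<oplus> f y" "f (bracket L x y) = bracket L (f x) (f y)"
proof -
  have f0: "f \<zero> = \<zero>" using homog[of \<zero> 0] f by simp
  define U where "U = {u :: bool list. length u \<le> N}"
  have U: "finite U" "[] \<in> U"
    unfolding U_def using finite_lists_length_le[of "UNIV :: bool set" N] by simp_all
  have common: "\<exists>n::nat. n > 0 \<and> of_nat n \<odot> x \<in> H \<and> of_nat n \<odot> y \<in> H"
    if x: "x \<in> carrier L" and y: "y \<in> carrier L" for x y
  proof -
    obtain m n :: nat where mn: "m > 0" "of_nat m \<odot> x \<in> H" "n > 0" "of_nat n \<odot> y \<in> H"
      using H(1) x y by meson
    then have "of_nat (n * m) \<odot> x \<in> H" "of_nat (n * m) \<odot> y \<in> H"
      using H(2)[OF mn(2), of n] H(2)[OF mn(4), of m] x y by (simp_all add: smult_smult mult.commute)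
    then show ?thesis using mn by (intro exI[of _ "n * m"]) simp
  qed
  \<comment> \<open>Only y is confined to \<gamma> i while x is arbitrary; this already puts [x, y]
    and all corrections into \<gamma> (Suc i), where the previous stage applies.\<close>
  have main: "\<forall>x\<in>carrier L. \<forall>y\<in>\<gamma> i. f (x \<oplus> y) = f x \<oplus> f y \<and> f (bracket L x y) = bracket L (f x) (f y)"
    if "i \<le> N" for i
    using that
  proof (induction i rule: inc_induct)
    case base
    then show ?case using nil f f0 by simp
  next
    case (step i)
    have add: "f (x \<oplus> v) = f x \<oplus> f v" and brk: "f (bracket L x v) = bracket L (f x) (f v)"
      if "x \<in> carrier L" "v \<in> \<gamma> (Suc i)" for x v
      using step.IH that by blast+
    have f_finsum: "f (finsum L h V) = finsum L (\<lambda>u. f (h u)) V"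
      if "finite V" "\<And>u. u \<in> V \<Longrightarrow> h u \<in> \<gamma> (Suc i)" for h and V :: "bool list set"
      using that
    proof (induction V)
      case (insert u V)
      have "h \<in> V \<rightarrow> carrier L" "h u \<in> carrier L" using insert \<gamma>_carrier by blast+
      moreover have "(\<lambda>u. f (h u)) \<in> V \<rightarrow> carrier L" "f (h u) \<in> carrier L"
        using calculation f by blast+
      moreover have "finsum L h V \<in> \<gamma> (Suc i)" using insert by (intro finsum_\<gamma>) blast
      ultimately show ?case
        using insert add[of "h u" "finsum L h V"] by (simp add: M.finsum_insert del: lie_lower_central.simps)
    qed (simp add: f0)
    have f_ad_word: "f (ad_word L g u v) = ad_word L (\<lambda>a. f (g a)) u (f v)"
      if "v \<in> \<gamma> (Suc i)" "\<And>a. g a \<in> carrier L" for g :: "bool \<Rightarrow> 'm" and u v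
    proof (induction u)
      case (Cons a u)
      have "ad_word L g u v \<in> \<gamma> (Suc i)"
        using ad_word_\<gamma>[of g v "Suc i" u] \<gamma>_antimono[of "Suc i" "Suc i + length u"] that by auto
      then show ?case using Cons brk that by simp
    qed simp
    have f_ad_sum: "f (ad_sum L k g U v) = ad_sum L k (\<lambda>a. f (g a)) U (f v)"
      if v: "v \<in> \<gamma> (Suc i)" and g: "\<And>a. g a \<in> carrier L" for k and g :: "bool \<Rightarrow> 'm" and v
    proof -
      have "ad_word L g u v \<in> \<gamma> (Suc i)" for u
        using ad_word_\<gamma>[of g v "Suc i" u] \<gamma>_antimono[of "Suc i" "Suc i + length u"] that by auto
      then have "f (ad_sum L k g U v) = finsum L (\<lambda>u. f (k u \<odot> ad_word L g u v)) U"
        unfolding ad_sum_def using U by (intro f_finsum \<gamma>_smult)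
      also have "\<dots> = ad_sum L k (\<lambda>a. f (g a)) U (f v)"
        unfolding ad_sum_def using f g \<gamma>_carrier[OF v]
        by (intro M.finsum_cong') (auto simp: homog f_ad_word[OF v g])
      finally show ?thesis .
    qed
    have onH: "f (x \<oplus> y) = f x \<oplus> f y \<and> f (bracket L x y) = bracket L (f x) (f y)"
      if xH: "x \<in> H" and yH: "y \<in> H" and x: "x \<in> carrier L" and yi: "y \<in> \<gamma> i" for x y
    proof -
      have y: "y \<in> carrier L" using \<gamma>_carrier[OF yi] .
      define g where "g = (\<lambda>b. if b then x else y)"
      define z where "z = bracket L x y"
      define k where "k u = bch_coeff u + bch_coeff (map Not u)" for u
      have k: "k [] = 1" by (simp add: k_def bch_coeff_Nil)
      have g: "g a \<in> carrier L" for a using x y by (simp add: g_def)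
      have fg: "(\<lambda>b. f (g b)) = (\<lambda>b. if b then f x else f y)" by (auto simp: g_def)
      have fgin: "f (g a) \<in> carrier L" for a using f g by blast
      have z: "z \<in> \<gamma> (Suc i)" unfolding z_def by (rule bracket_\<gamma>[OF x yi])
      have zc: "z \<in> carrier L" using \<gamma>_carrier[OF z] .
      note fx = f[OF x] and fy = f[OF y]
      have bxy: "bch L y x \<in> carrier L"
        unfolding bch_eq[OF nil y x] using x y by (intro M.a_closed ad_sum_in bracket_in) auto
      \<comment> \<open>The image of the swap identity is compared with the swap identity at f x and
        f y. After cancelling the common first summand, one unipotent operator takes equal values at
        f z and [f x, f y], so these coincide.\<close>
      have "f (bch L x y) = f (bch L y x) \<oplus> f (ad_sum L k g U z)"
        unfolding bch_swap_eq[OF nil x y] k_def[symmetric] g_def[symmetric] U_def[symmetric]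
          z_def[symmetric]
        by (rule add[OF bxy ad_sum_\<gamma>[OF g z]])
      then have "bch L (f x) (f y) = bch L (f y) (f x) \<oplus> ad_sum L k (\<lambda>a. f (g a)) U (f z)"
        unfolding bch[OF xH yH] bch[OF yH xH] f_ad_sum[OF z g] .
      moreover have "bch L (f x) (f y) =
          bch L (f y) (f x) \<oplus> ad_sum L k (\<lambda>a. f (g a)) U (bracket L (f x) (f y))"
        unfolding k_def fg U_def by (rule bch_swap_eq[OF nil fx fy])
      moreover have "bch L (f y) (f x) \<in> carrier L" using f[OF bxy] bch[OF yH xH] by simp
      moreover have "ad_sum L k (\<lambda>a. f (g a)) U (f z) \<in> carrier L"
        using fgin f[OF zc] by (rule ad_sum_in)
      moreover have "ad_sum L k (\<lambda>a. f (g a)) U (bracket L (f x) (f y)) \<in> carrier L"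
        using fgin bracket_in[OF fx fy] by (rule ad_sum_in)
      ultimately have "ad_sum L k (\<lambda>a. f (g a)) U (f z) =
          ad_sum L k (\<lambda>a. f (g a)) U (bracket L (f x) (f y))"
        using M.add.l_cancel by metis
      then have fz: "f z = bracket L (f x) (f y)"
        using ad_sum_inject[of N U k "\<lambda>a. f (g a)" "f z" "bracket L (f x) (f y)"] nil U k fgin
          f[OF zc] bracket_in[OF fx fy] by blast
      have s: "ad_sum L bch_coeff g U z \<in> \<gamma> (Suc i)" using g z by (rule ad_sum_\<gamma>)
      \<comment> \<open>With f z known, the corrections in the two expansions of \<open>bch\<close>
        agree, and cancelling them leaves additivity.\<close>
      have "f (x \<oplus> y) \<oplus> f (ad_sum L bch_coeff g U z) = f (bch L x y)"
        unfolding bch_eq[OF nil x y] g_def[symmetric] U_def[symmetric] z_def[symmetric]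
        by (rule add[symmetric, OF M.a_closed[OF x y] s])
      also have "\<dots> = f x \<oplus> f y \<oplus> ad_sum L bch_coeff (\<lambda>a. f (g a)) U (bracket L (f x) (f y))"
        unfolding bch[OF xH yH] fg U_def by (rule bch_eq[OF nil fx fy])
      also have "ad_sum L bch_coeff (\<lambda>a. f (g a)) U (bracket L (f x) (f y)) =
          f (ad_sum L bch_coeff g U z)"
        unfolding f_ad_sum[OF z g] fz ..
      finally have "f (x \<oplus> y) = f x \<oplus> f y"
        using f[OF \<gamma>_carrier[OF s]] fx fy f[OF M.a_closed[OF x y]] by simp
      then show ?thesis using fz z_def by simp
    qed
    show ?case
    proof (intro ballI)
      fix x y assume x: "x \<in> carrier L" and yi: "y \<in> \<gamma> i"
      have y: "y \<in> carrier L" using \<gamma>_carrier[OF yi] .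
      obtain n :: nat where n: "n > 0" "of_nat n \<odot> x \<in> H" "of_nat n \<odot> y \<in> H"
        using common[OF x y] by blast
      \<comment> \<open>Scaling by a common n moves both arguments into H. The factor comes out once
        from the sum and twice from the bracket, and is then cancelled.\<close>
      let ?q = "of_nat n :: rat"
      have q: "?q \<noteq> 0" using n by simp
      have *: "f (?q \<odot> x \<oplus> ?q \<odot> y) = f (?q \<odot> x) \<oplus> f (?q \<odot> y)"
        "f (bracket L (?q \<odot> x) (?q \<odot> y)) = bracket L (f (?q \<odot> x)) (f (?q \<odot> y))"
        using onH[OF n(2,3) smult_in[OF x] \<gamma>_smult[OF yi]] by blast+
      have "?q \<odot> f (x \<oplus> y) = ?q \<odot> (f x \<oplus> f y)"
        using *(1) x y f by (simp add: homog smult_add_right flip: smult_add_right)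
      moreover have "(?q * ?q) \<odot> f (bracket L x y) = (?q * ?q) \<odot> bracket L (f x) (f y)"
        using *(2) x y f by (simp add: homog bracket_smult_left bracket_smult_right smult_smult)
      moreover have "?q * ?q \<noteq> 0" using q by simp
      ultimately show "f (x \<oplus> y) = f x \<oplus> f y \<and> f (bracket L x y) = bracket L (f x) (f y)"
        using smult_cancel[OF q f[OF M.a_closed[OF x y]] M.a_closed[OF f[OF x] f[OF y]]]
          smult_cancel[OF _ f[OF bracket_in[OF x y]] bracket_in[OF f[OF x] f[OF y]]] by blast
    qed
  qed
  show "f (x \<oplus> y) = f x \<oplus> f y" "f (bracket L x y) = bracket L (f x) (f y)"
    using main[of 0] x y by simp_all
qed

section \<open>From Lie homomorphisms back to the Baker-Campbell-Hausdorff operation\<close>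

lemma lie_hom_right_normed:
  assumes "\<And>x. x \<in> carrier L \<Longrightarrow> f x \<in> carrier L" "f \<zero> = \<zero>"
    and "\<And>x y. x \<in> carrier L \<Longrightarrow> y \<in> carrier L \<Longrightarrow> f (bracket L x y) = bracket L (f x) (f y)"
    and "set xs \<subseteq> carrier L"
  shows "right_normed L xs \<in> carrier L \<and> f (right_normed L xs) = right_normed L (map f xs)"
  using assms(4)
proof (induction xs)
  case (Cons a xs)
  then show ?case using assms(1-3) by (cases xs) auto
qed (simp add: assms(2))

text \<open>Apply f term by term. The delicate point is the index set: \<open>bch\<close> sums over
  the nonzero brackets, and injectivity makes these the same words for x, y as for f x, f y.\<close>

lemma lie_hom_bch:
  assumes f: "\<And>x. x \<in> carrier L \<Longrightarrow> f x \<in> carrier L" and inj: "inj_on f (carrier L)"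
    and homog: "\<And>q x. x \<in> carrier L \<Longrightarrow> f (q \<odot> x) = q \<odot> f x"
    and add: "\<And>x y. x \<in> carrier L \<Longrightarrow> y \<in> carrier L \<Longrightarrow> f (x \<oplus> y) = f x \<oplus> f y"
    and brk: "\<And>x y. x \<in> carrier L \<Longrightarrow> y \<in> carrier L \<Longrightarrow> f (bracket L x y) = bracket L (f x) (f y)"
    and x: "x \<in> carrier L" and y: "y \<in> carrier L"
  shows "f (bch L x y) = bch L (f x) (f y)"
proof -
  have f0: "f \<zero> = \<zero>" using homog[of \<zero> 0] f by simp
  have f_finsum: "f (finsum L h V) = finsum L (\<lambda>u. f (h u)) V"
    if "\<And>u. u \<in> V \<Longrightarrow> h u \<in> carrier L" for h and V :: "bool list set"
    using that
  proof (induction V rule: infinite_finite_induct)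
    case (insert u V)
    have "h \<in> V \<rightarrow> carrier L" "h u \<in> carrier L" using insert by blast+
    moreover have "(\<lambda>u. f (h u)) \<in> V \<rightarrow> carrier L" "f (h u) \<in> carrier L"
      using calculation f by blast+
    ultimately show ?case using insert by (simp add: M.finsum_insert add M.finsum_closed)
  qed (simp_all add: f0 M.finsum_infinite)
  define br where "br a b w = right_normed L (map (\<lambda>c. if c then a else b) w)" for a b w
  have br: "br x y w \<in> carrier L \<and> f (br x y w) = br (f x) (f y) w" for w
  proof -
    have "map f (map (\<lambda>c. if c then x else y) w) = map (\<lambda>c. if c then f x else f y) w" by simp
    moreover have "set (map (\<lambda>c. if c then x else y) w) \<subseteq> carrier L" using x y by auto
    ultimately show ?thesis
      unfolding br_def using lie_hom_right_normed[of f, OF f f0 brk] by metis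
  qed
  have "br (f x) (f y) w \<noteq> \<zero> \<longleftrightarrow> br x y w \<noteq> \<zero>" for w
    using br[of w] f0 inj M.zero_closed by (metis inj_onD)
  then have V: "{w. br (f x) (f y) w \<noteq> \<zero>} = {w. br x y w \<noteq> \<zero>}" by simp
  have "f (bch L x y) = finsum L (\<lambda>w. f ((bch_series w / of_nat (length w)) \<odot> br x y w)) {w. br x y w \<noteq> \<zero>}"
    unfolding bch_def Let_def br_def[symmetric] using br by (intro f_finsum) blast
  also have "\<dots> = bch L (f x) (f y)"
    unfolding bch_def Let_def br_def[symmetric] V using br homog by simp
  finally show ?thesis .
qed

end

section \<open>Virtual automorphisms and automorphisms of the Lie algebra\<close>

lemma (in group) power_dense_pow_mult:
  assumes "power_dense H G" "h [^] (n::nat) \<in> H" "h \<in> carrier G"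
  shows "h [^] (n * m) \<in> H"
  using assms subgroup_int_pow_closed[of H "h [^] n" "int m"]
  by (simp add: power_dense_def int_pow_int nat_pow_pow)

lemma (in group) power_dense_Int:
  assumes H: "power_dense H G" and K: "power_dense K G"
  shows "power_dense (H \<inter> K) G"
  unfolding power_dense_def
proof (intro conjI ballI)
  show "subgroup (H \<inter> K) G"
    using H K by (intro subgroups_Inter_pair) (simp_all add: power_dense_def)
  fix g assume g: "g \<in> carrier G"
  obtain m n :: nat where mn: "m > 0" "g [^] m \<in> H" "n > 0" "g [^] n \<in> K"
    using H K g by (meson power_dense_def)
  have "g [^] (m * n) \<in> H" "g [^] (m * n) \<in> K"
    using power_dense_pow_mult[OF H mn(2) g, of n] power_dense_pow_mult[OF K mn(4) g, of m]
    by (simp_all add: mult.commute)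
  then show "\<exists>n::nat. n > 0 \<and> g [^] n \<in> H \<inter> K" using mn by (intro exI[of _ "m * n"]) simp
qed

lemma (in group) finite_index_in_subgroup:
  assumes M: "finite_index M G" and H: "subgroup H G" and "M \<subseteq> H"
  shows "finite_index M (G\<lparr>carrier := H\<rparr>)"
proof -
  have "subgroup M (G\<lparr>carrier := H\<rparr>)"
    using M H \<open>M \<subseteq> H\<close> subgroup_incl by (simp add: finite_index_def)
  moreover have "rcosets\<^bsub>G\<lparr>carrier := H\<rparr>\<^esub> M \<subseteq> rcosets M"
    using subgroup.subset[OF H] unfolding RCOSETS_def r_coset_def by auto
  ultimately show ?thesis using M finite_subset unfolding finite_index_def by blast
qed

text \<open>A relation in place of an extension operator: one \<alpha> represents all members of a
  class, and existence in both directions is proved separately from uniqueness.\<close>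

definition represents ::
  "('a \<Rightarrow> 'd) \<Rightarrow> ('a \<rightharpoonup> 'a) \<Rightarrow> ('d \<Rightarrow> 'd) \<Rightarrow> bool" where
  "represents \<iota> \<phi> \<alpha> \<longleftrightarrow> (\<forall>x\<in>dom \<phi>. \<iota> (the (\<phi> x)) = \<alpha> (\<iota> x))"

section \<open>The hull as a Lie algebra: powers and multiples\<close>

locale malcev_hull =
  fixes G :: "('a, 'b) monoid_scheme"
    and D :: "('d, 'e) monoid_scheme"
    and \<iota> :: "'a \<Rightarrow> 'd"
    and L :: "(rat, 'd, 'c) lie_alg_scheme"
  assumes group_G: "group G"
    and fg: "finitely_generated G"
    and nil_G: "nilpotent_group G"
    and hull: "is_divisible_hull G \<iota> D"
    and malcev: "is_malcev_lie_algebra D L"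
begin

sublocale G: group G by (rule group_G)

sublocale D: group D using hull by (simp add: is_divisible_hull_def nilpotent_group_def)

sublocale L: rational_lie_algebra L
  using malcev by (simp add: is_malcev_lie_algebra_def nilpotent_lie_algebra_def rational_lie_algebra_def)

lemma carrier_eq: "carrier D = carrier L"
  using malcev by (simp add: is_malcev_lie_algebra_def)

lemma mult_eq: "x \<in> carrier L \<Longrightarrow> y \<in> carrier L \<Longrightarrow> x \<otimes>\<^bsub>D\<^esub> y = bch L x y"
  using malcev by (simp add: is_malcev_lie_algebra_def)

text \<open>For an integer exponent the denominator in \<open>rat_pow\<close> is 1, so the root
  selected there is the power itself.\<close>

lemma smult_of_int:
  assumes "a \<in> carrier L"
  shows "of_int k \<odot>\<^bsub>L\<^esub> a = a [^]\<^bsub>D\<^esub> k"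
proof -
  have a: "a \<in> carrier D" using assms carrier_eq by simp
  have "of_int k \<odot>\<^bsub>L\<^esub> a = rat_pow D a (of_int k)"
    using malcev a by (simp add: is_malcev_lie_algebra_def)
  also have "\<dots> = (THE x. x \<in> carrier D \<and> x [^]\<^bsub>D\<^esub> (1::int) = a [^]\<^bsub>D\<^esub> k)"
    by (simp add: rat_pow_def)
  also have "\<dots> = a [^]\<^bsub>D\<^esub> k"
    using a by (intro the_equality) (auto simp: D.int_pow_1)
  finally show ?thesis .
qed

lemma \<iota>_in [simp, intro]: "g \<in> carrier G \<Longrightarrow> \<iota> g \<in> carrier L"
  using hull carrier_eq by (auto simp: is_divisible_hull_def hom_def)

lemma \<iota>_hom: "group_hom G D \<iota>"
  using hull by (simp add: is_divisible_hull_def group_hom_def group_hom_axioms_def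
      G.group_axioms D.group_axioms)

lemma \<iota>_mult: "g \<in> carrier G \<Longrightarrow> h \<in> carrier G \<Longrightarrow> \<iota> (g \<otimes>\<^bsub>G\<^esub> h) = bch L (\<iota> g) (\<iota> h)"
  using group_hom.hom_mult[OF \<iota>_hom] mult_eq by simp

lemma \<iota>_inj: "\<iota> g = \<iota> h \<Longrightarrow> g \<in> carrier G \<Longrightarrow> h \<in> carrier G \<Longrightarrow> g = h"
  using hull by (meson inj_onD is_divisible_hull_def)

lemma \<iota>_int_pow: "g \<in> carrier G \<Longrightarrow> \<iota> (g [^]\<^bsub>G\<^esub> (k::int)) = of_int k \<odot>\<^bsub>L\<^esub> \<iota> g"
  using group_hom.hom_int_pow[OF \<iota>_hom, of g k] smult_of_int by simp

lemma \<iota>_pow: "g \<in> carrier G \<Longrightarrow> \<iota> (g [^]\<^bsub>G\<^esub> (n::nat)) = of_nat n \<odot>\<^bsub>L\<^esub> \<iota> g"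
  using \<iota>_int_pow[of g "int n"] by (simp add: int_pow_int)

text \<open>Two powers in succession: one brings d into the image of G, by definition of the hull,
  and another brings the resulting element of G into H.\<close>

lemma multiple_in_image:
  assumes H: "power_dense H G" and d: "d \<in> carrier L"
  obtains n :: nat and h where "n > 0" "h \<in> H" "h \<in> carrier G" "of_nat n \<odot>\<^bsub>L\<^esub> d = \<iota> h"
proof -
  obtain m :: nat and g where m: "m > 0" "g \<in> carrier G" "d [^]\<^bsub>D\<^esub> m = \<iota> g"
    using hull d carrier_eq unfolding is_divisible_hull_def by (metis imageE)
  obtain n :: nat where n: "n > 0" "g [^]\<^bsub>G\<^esub> n \<in> H"
    using H m unfolding power_dense_def by blast
  have "of_nat m \<odot>\<^bsub>L\<^esub> d = \<iota> g" using smult_of_int[OF d, of "int m"] m by (simp add: int_pow_int)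
  then have "of_nat (n * m) \<odot>\<^bsub>L\<^esub> d = \<iota> (g [^]\<^bsub>G\<^esub> n)"
    using \<iota>_pow[OF m(2), of n] d by (simp flip: L.smult_smult)
  then show thesis using that[of "n * m" "g [^]\<^bsub>G\<^esub> n"] m n by simp
qed

lemma of_nat_smult_cancel:
  "n > 0 \<Longrightarrow> x \<in> carrier L \<Longrightarrow> y \<in> carrier L \<Longrightarrow> of_nat n \<odot>\<^bsub>L\<^esub> x = of_nat n \<odot>\<^bsub>L\<^esub> y \<Longrightarrow> x = y"
  using L.smult_cancel[of "of_nat n" x y] by simp

section \<open>Automorphisms of L and their values on power dense subgroups\<close>

abbreviation "A \<equiv> lie_auto rat_ring L"

lemma
  assumes "\<alpha> \<in> A"
  shows lie_auto_bij: "bij_betw \<alpha> (carrier L) (carrier L)"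
    and lie_auto_in: "x \<in> carrier L \<Longrightarrow> \<alpha> x \<in> carrier L"
    and lie_auto_smult: "x \<in> carrier L \<Longrightarrow> \<alpha> (q \<odot>\<^bsub>L\<^esub> x) = q \<odot>\<^bsub>L\<^esub> \<alpha> x"
    and lie_auto_bch: "x \<in> carrier L \<Longrightarrow> y \<in> carrier L \<Longrightarrow> \<alpha> (bch L x y) = bch L (\<alpha> x) (\<alpha> y)"
proof -
  show b: "bij_betw \<alpha> (carrier L) (carrier L)" using assms by (simp add: lie_auto_def Bij_def)
  show i: "\<alpha> x \<in> carrier L" if "x \<in> carrier L" for x using b that bij_betwE by blast
  show s: "\<alpha> (q \<odot>\<^bsub>L\<^esub> x) = q \<odot>\<^bsub>L\<^esub> \<alpha> x" if "x \<in> carrier L" for q x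
    using assms that by (simp add: lie_auto_def)
  show "\<alpha> (bch L x y) = bch L (\<alpha> x) (\<alpha> y)" if "x \<in> carrier L" "y \<in> carrier L" for x y
  proof (rule L.lie_hom_bch[OF i bij_betw_imp_inj_on[OF b] s _ _ that])
    show "\<alpha> (x \<oplus>\<^bsub>L\<^esub> y) = \<alpha> x \<oplus>\<^bsub>L\<^esub> \<alpha> y" if "x \<in> carrier L" "y \<in> carrier L" for x y
      using assms that by (simp add: lie_auto_def)
    show "\<alpha> (bracket L x y) = bracket L (\<alpha> x) (\<alpha> y)" if "x \<in> carrier L" "y \<in> carrier L" for x y
      using assms that by (simp add: lie_auto_def)
  qed
qed

text \<open>Some multiple n d lies in the image of H, and homogeneity lets n be cancelled. Elements
  of \<open>A\<close> are extensional, so agreement on the carrier is equality.\<close>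

lemma lie_auto_eqI:
  assumes \<alpha>: "\<alpha> \<in> A" and \<beta>: "\<beta> \<in> A" and H: "power_dense H G"
    and eq: "\<And>h. h \<in> H \<Longrightarrow> \<alpha> (\<iota> h) = \<beta> (\<iota> h)"
  shows "\<alpha> = \<beta>"
proof (rule extensionalityI)
  show "\<alpha> \<in> extensional (carrier L)" "\<beta> \<in> extensional (carrier L)"
    using \<alpha> \<beta> by (simp_all add: lie_auto_def Bij_def)
  fix d assume d: "d \<in> carrier L"
  obtain n :: nat and h where "n > 0" "h \<in> H" "of_nat n \<odot>\<^bsub>L\<^esub> d = \<iota> h"
    using multiple_in_image[OF H d] by metis
  then have "of_nat n \<odot>\<^bsub>L\<^esub> \<alpha> d = of_nat n \<odot>\<^bsub>L\<^esub> \<beta> d"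
    using eq[of h] d lie_auto_smult[OF \<alpha> d] lie_auto_smult[OF \<beta> d] by metis
  then show "\<alpha> d = \<beta> d"
    using of_nat_smult_cancel \<open>n > 0\<close> lie_auto_in[OF \<alpha> d] lie_auto_in[OF \<beta> d] by blast
qed

lemma compose_lie_auto:
  assumes \<alpha>: "\<alpha> \<in> A" and \<beta>: "\<beta> \<in> A"
  shows "compose (carrier L) \<alpha> \<beta> \<in> A"
proof -
  have "compose (carrier L) \<alpha> \<beta> \<in> Bij (carrier L)"
    using \<alpha> \<beta> by (intro compose_Bij) (simp_all add: lie_auto_def)
  then show ?thesis
    using \<alpha> \<beta> lie_auto_in[OF \<beta>] by (simp add: lie_auto_def compose_def)
qed

section \<open>Passing between virtual automorphisms and automorphisms of L\<close>

lemma virtual_auto_power_dense: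
  assumes "\<phi> \<in> virtual_autos G"
  shows "power_dense (dom \<phi>) G" "power_dense (ran \<phi>) G"
  using assms G.power_dense_if_finite_index by (auto simp: virtual_autos_def)

lemma virtual_auto_in:
  assumes "\<phi> \<in> virtual_autos G" "x \<in> dom \<phi>"
  shows "x \<in> carrier G" "the (\<phi> x) \<in> ran \<phi>" "the (\<phi> x) \<in> carrier G"
proof -
  have "subgroup (dom \<phi>) G" "subgroup (ran \<phi>) G"
    using virtual_auto_power_dense[OF assms(1)] by (simp_all add: power_dense_def)
  note sub = this[THEN subgroup.subset]
  show "the (\<phi> x) \<in> ran \<phi>" using assms(2) by (auto simp: ran_def)
  then show "x \<in> carrier G" "the (\<phi> x) \<in> carrier G" using assms(2) sub by blast+
qed

text \<open>Injectivity and multiplicativity are inherited from \<alpha>. The range is power dense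
  because \<iota> g = \<alpha> d for some d, a multiple of d comes from the domain, and \<alpha>
  carries it to a power of g.\<close>

lemma virtual_autosI:
  assumes \<alpha>: "\<alpha> \<in> A" and H: "power_dense (dom \<phi>) G" and rep: "represents \<iota> \<phi> \<alpha>"
    and ran: "ran \<phi> \<subseteq> carrier G"
  shows "\<phi> \<in> virtual_autos G"
proof -
  define p where "p x = the (\<phi> x)" for x
  have Hs: "subgroup (dom \<phi>) G" using H by (simp add: power_dense_def)
  note Hc = subgroup.mem_carrier[OF Hs]
  have p: "p x \<in> carrier G" "\<iota> (p x) = \<alpha> (\<iota> x)" if "x \<in> dom \<phi>" for x
    using that ran rep by (auto simp: p_def represents_def ran_def)
  have ran_eq: "ran \<phi> = p ` dom \<phi>" by (force simp: p_def ran_def dom_def)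
  have mult: "p (x \<otimes>\<^bsub>G\<^esub> y) = p x \<otimes>\<^bsub>G\<^esub> p y" if "x \<in> dom \<phi>" "y \<in> dom \<phi>" for x y
  proof (rule \<iota>_inj)
    have xy: "x \<otimes>\<^bsub>G\<^esub> y \<in> dom \<phi>" using that subgroup.m_closed[OF Hs] by blast
    show "\<iota> (p (x \<otimes>\<^bsub>G\<^esub> y)) = \<iota> (p x \<otimes>\<^bsub>G\<^esub> p y)"
      using p(2)[OF xy] p[OF that(1)] p[OF that(2)] \<iota>_mult Hc that lie_auto_bch[OF \<alpha>] by simp
    show "p (x \<otimes>\<^bsub>G\<^esub> y) \<in> carrier G" using p(1)[OF xy] .
    show "p x \<otimes>\<^bsub>G\<^esub> p y \<in> carrier G" using p(1) that by simp
  qed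
  have inj: "inj_on p (dom \<phi>)"
  proof (rule inj_onI)
    fix x y assume xy: "x \<in> dom \<phi>" "y \<in> dom \<phi>" "p x = p y"
    then have "\<alpha> (\<iota> x) = \<alpha> (\<iota> y)" using p(2) by metis
    then have "\<iota> x = \<iota> y"
      using bij_betw_imp_inj_on[OF lie_auto_bij[OF \<alpha>]] xy Hc \<iota>_in by (meson inj_onD)
    then show "x = y" using \<iota>_inj xy Hc by blast
  qed
  have "group_hom (G\<lparr>carrier := dom \<phi>\<rparr>) G p"
    unfolding group_hom_def group_hom_axioms_def
    using G.subgroup_imp_group[OF Hs] G.group_axioms p(1) mult by (auto simp: hom_def)
  then have rs: "subgroup (ran \<phi>) G" using group_hom.img_is_subgroup ran_eq by fastforce
  have "\<exists>n::nat. n > 0 \<and> g [^]\<^bsub>G\<^esub> n \<in> ran \<phi>" if g: "g \<in> carrier G" for g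
  proof -
    obtain d where d: "d \<in> carrier L" "\<alpha> d = \<iota> g"
      using lie_auto_bij[OF \<alpha>] \<iota>_in[OF g] unfolding bij_betw_def by (metis imageE)
    obtain n :: nat and h where n: "n > 0" "h \<in> dom \<phi>" "of_nat n \<odot>\<^bsub>L\<^esub> d = \<iota> h"
      using multiple_in_image[OF H d(1)] by metis
    have "\<iota> (p h) = \<iota> (g [^]\<^bsub>G\<^esub> n)"
      using p(2)[OF n(2)] n(3) lie_auto_smult[OF \<alpha> d(1), of "of_nat n"] d(2) \<iota>_pow[OF g, of n] by simp
    then have "p h = g [^]\<^bsub>G\<^esub> n" using \<iota>_inj p(1)[OF n(2)] g by simp
    then show ?thesis using n ran_eq by (metis imageI)
  qed
  then have "power_dense (ran \<phi>) G" using rs by (simp add: power_dense_def)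
  then have "finite_index (dom \<phi>) G" "finite_index (ran \<phi>) G"
    using G.finite_index_if_power_dense fg nil_G H by blast+
  moreover have "p \<in> iso (G\<lparr>carrier := dom \<phi>\<rparr>) (G\<lparr>carrier := ran \<phi>\<rparr>)"
    using inj ran_eq mult by (auto simp: iso_def hom_def bij_betw_def)
  ultimately show ?thesis unfolding virtual_autos_def p_def by simp
qed

text \<open>The witness is the largest restriction of \<alpha> to G. Its domain is the preimage of a
  subgroup under a homomorphism, and it is power dense because some multiple of \<alpha> (\<iota> g)
  lies in the image of G.\<close>

lemma lie_auto_represented:
  assumes \<alpha>: "\<alpha> \<in> A"
  shows "\<exists>\<phi>\<in>virtual_autos G. represents \<iota> \<phi> \<alpha>"
proof -
  define \<phi> where "\<phi> g = (if g \<in> carrier G \<and> \<alpha> (\<iota> g) \<in> \<iota> ` carrier G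
    then Some (inv_into (carrier G) \<iota> (\<alpha> (\<iota> g))) else None)" for g
  have dom: "dom \<phi> = {g \<in> carrier G. \<alpha> (\<iota> g) \<in> \<iota> ` carrier G}"
    by (auto simp: \<phi>_def dom_def)
  have rep: "represents \<iota> \<phi> \<alpha>"
    by (auto simp: represents_def \<phi>_def f_inv_into_f split: if_splits)
  have ran: "ran \<phi> \<subseteq> carrier G"
    by (auto simp: ran_def \<phi>_def inv_into_into split: if_splits)
  have "group_hom G D (\<lambda>g. \<alpha> (\<iota> g))"
    unfolding group_hom_def group_hom_axioms_def
    using G.group_axioms D.group_axioms lie_auto_in[OF \<alpha>] lie_auto_bch[OF \<alpha>]
    by (auto simp: hom_def carrier_eq \<iota>_mult mult_eq)
  then interpret h: group_hom G D "\<lambda>g. \<alpha> (\<iota> g)" .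
  interpret i: group_hom G D \<iota> by (rule \<iota>_hom)
  have img: "subgroup (\<iota> ` carrier G) D" by (rule i.img_is_subgroup)
  have "subgroup (dom \<phi>) G"
  proof (rule G.subgroupI)
    show "dom \<phi> \<subseteq> carrier G" using dom by blast
    show "dom \<phi> \<noteq> {}" using dom h.hom_one subgroup.one_closed[OF img] by fastforce
    show "inv\<^bsub>G\<^esub> a \<in> dom \<phi>" if "a \<in> dom \<phi>" for a
      using that subgroup.m_inv_closed[OF img, of "\<alpha> (\<iota> a)"] h.hom_inv[of a]
      by (simp add: dom del: i.hom_inv)
    show "a \<otimes>\<^bsub>G\<^esub> b \<in> dom \<phi>" if "a \<in> dom \<phi>" "b \<in> dom \<phi>" for a b
      using that subgroup.m_closed[OF img, of "\<alpha> (\<iota> a)" "\<alpha> (\<iota> b)"] h.hom_mult[of a b] by (simp add: dom)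
  qed
  moreover have "\<exists>n::nat. n > 0 \<and> g [^]\<^bsub>G\<^esub> n \<in> dom \<phi>" if g: "g \<in> carrier G" for g
  proof -
    have "power_dense (carrier G) G" using G.subgroup_self by (auto simp: power_dense_def)
    then obtain n :: nat and h where n: "n > 0" "h \<in> carrier G" "of_nat n \<odot>\<^bsub>L\<^esub> \<alpha> (\<iota> g) = \<iota> h"
      using multiple_in_image lie_auto_in[OF \<alpha> \<iota>_in[OF g]] by metis
    then have "\<alpha> (\<iota> (g [^]\<^bsub>G\<^esub> n)) = \<iota> h"
      using \<iota>_pow[OF g] lie_auto_smult[OF \<alpha> \<iota>_in[OF g]] by simp
    then show ?thesis using n g by (auto simp: dom)
  qed
  ultimately have "power_dense (dom \<phi>) G" by (simp add: power_dense_def)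
  then show ?thesis using virtual_autosI[OF \<alpha> _ rep ran] rep by blast
qed

text \<open>If n d = \<iota> h, the extension must send d to \<iota> (p h) divided by n. Once this
  is seen to be independent of n and h and homogeneous, \<open>lie_hom_if_bch_hom\<close> yields
  additivity and the bracket.\<close>

lemma virtual_auto_represents:
  assumes \<phi>: "\<phi> \<in> virtual_autos G"
  shows "\<exists>\<alpha>\<in>A. represents \<iota> \<phi> \<alpha>"
proof -
  define p where "p x = the (\<phi> x)" for x
  let ?H = "dom \<phi>"
  note H = virtual_auto_power_dense(1)[OF \<phi>] and ran = virtual_auto_power_dense(2)[OF \<phi>]
  have Hs: "subgroup ?H G" using H by (simp add: power_dense_def)
  have Hc: "x \<in> carrier G" and pc: "p x \<in> carrier G" if "x \<in> ?H" for x
    using virtual_auto_in[OF \<phi> that] by (simp_all add: p_def)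
  have piso: "p \<in> iso (G\<lparr>carrier := ?H\<rparr>) (G\<lparr>carrier := ran \<phi>\<rparr>)"
    using \<phi> unfolding virtual_autos_def p_def by simp
  have pinj: "x = y" if "p x = p y" "x \<in> ?H" "y \<in> ?H" for x y
    using piso that by (auto simp: iso_def bij_betw_def dest: inj_onD)
  have psurj: "p ` ?H = ran \<phi>" using piso by (auto simp: iso_def bij_betw_def)
  have pmult: "p (x \<otimes>\<^bsub>G\<^esub> y) = p x \<otimes>\<^bsub>G\<^esub> p y" if "x \<in> ?H" "y \<in> ?H" for x y
    using piso that by (auto simp: iso_def hom_def)
  have phom: "group_hom (G\<lparr>carrier := ?H\<rparr>) G p"
    unfolding group_hom_def group_hom_axioms_def
    using G.subgroup_imp_group[OF Hs] G.group_axioms pc pmult by (auto simp: hom_def)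
  have ppow: "x [^]\<^bsub>G\<^esub> k \<in> ?H \<and> p (x [^]\<^bsub>G\<^esub> k) = p x [^]\<^bsub>G\<^esub> k" if "x \<in> ?H" for x and k :: int
    using G.subgroup_int_pow_closed[OF Hs that] group_hom.hom_int_pow[OF phom, of x k]
      G.int_pow_consistent[OF Hs that] that by simp
  have \<iota>pow: "x [^]\<^bsub>G\<^esub> k \<in> ?H \<and> \<iota> (x [^]\<^bsub>G\<^esub> k) = of_int k \<odot>\<^bsub>L\<^esub> \<iota> x \<and>
      \<iota> (p (x [^]\<^bsub>G\<^esub> k)) = of_int k \<odot>\<^bsub>L\<^esub> \<iota> (p x)" if "x \<in> ?H" for x and k :: int
    using ppow[OF that] \<iota>_int_pow Hc pc that by simp
  have \<iota>npow: "x [^]\<^bsub>G\<^esub> n \<in> ?H \<and> \<iota> (x [^]\<^bsub>G\<^esub> n) = of_nat n \<odot>\<^bsub>L\<^esub> \<iota> x \<and>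
      \<iota> (p (x [^]\<^bsub>G\<^esub> n)) = of_nat n \<odot>\<^bsub>L\<^esub> \<iota> (p x)" if "x \<in> ?H" for x and n :: nat
    using \<iota>pow[OF that, of "int n"] by (simp add: int_pow_int)
  have ex: "\<exists>e\<in>carrier L. \<forall>n h. n > 0 \<longrightarrow> h \<in> ?H \<longrightarrow> of_nat n \<odot>\<^bsub>L\<^esub> d = \<iota> h \<longrightarrow>
      of_nat n \<odot>\<^bsub>L\<^esub> e = \<iota> (p h)" if d: "d \<in> carrier L" for d
  proof -
    obtain m :: nat and k where m: "m > 0" "k \<in> ?H" "of_nat m \<odot>\<^bsub>L\<^esub> d = \<iota> k"
      using multiple_in_image[OF H d] by metis
    define e where "e = (1 / of_nat m) \<odot>\<^bsub>L\<^esub> \<iota> (p k)"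
    have e: "e \<in> carrier L" using pc m by (simp add: e_def)
    have me: "of_nat m \<odot>\<^bsub>L\<^esub> e = \<iota> (p k)" using pc m by (simp add: e_def L.smult_smult)
    have "of_nat n \<odot>\<^bsub>L\<^esub> e = \<iota> (p h)" if n: "n > 0" "h \<in> ?H" "of_nat n \<odot>\<^bsub>L\<^esub> d = \<iota> h" for n h
    proof -
      \<comment> \<open>Both powers lie over the multiple (m n) d, so they coincide in G and p can
        be applied to the equality.\<close>
      have "\<iota> (k [^]\<^bsub>G\<^esub> n) = \<iota> (h [^]\<^bsub>G\<^esub> m)"
        using \<iota>npow[OF m(2), of n] \<iota>npow[OF n(2), of m] d
        by (simp add: L.smult_smult mult.commute flip: m(3) n(3))
      then have "k [^]\<^bsub>G\<^esub> n = h [^]\<^bsub>G\<^esub> m" using \<iota>_inj Hc m n by simp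
      then have "of_nat n \<odot>\<^bsub>L\<^esub> \<iota> (p k) = of_nat m \<odot>\<^bsub>L\<^esub> \<iota> (p h)"
        using \<iota>npow[OF m(2), of n] \<iota>npow[OF n(2), of m] by metis
      then have "of_nat m \<odot>\<^bsub>L\<^esub> (of_nat n \<odot>\<^bsub>L\<^esub> e) = of_nat m \<odot>\<^bsub>L\<^esub> \<iota> (p h)"
        unfolding me[symmetric] using e by (simp add: L.smult_smult mult.commute)
      then show ?thesis using of_nat_smult_cancel[OF m(1)] e pc[OF n(2)] by blast
    qed
    then show ?thesis using e by blast
  qed
  \<comment> \<open>The value \<open>undefined\<close> off the carrier makes f extensional, as
    \<open>Bij\<close> demands.\<close>
  define f where "f d = (if d \<in> carrier L then (SOME e. e \<in> carrier L \<and> (\<forall>n h. n > 0 \<longrightarrow> h \<in> ?H \<longrightarrow>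
      of_nat n \<odot>\<^bsub>L\<^esub> d = \<iota> h \<longrightarrow> of_nat n \<odot>\<^bsub>L\<^esub> e = \<iota> (p h))) else undefined)" for d
  have fspec: "f d \<in> carrier L \<and> (\<forall>n h. n > 0 \<longrightarrow> h \<in> ?H \<longrightarrow>
      of_nat n \<odot>\<^bsub>L\<^esub> d = \<iota> h \<longrightarrow> of_nat n \<odot>\<^bsub>L\<^esub> f d = \<iota> (p h))" if "d \<in> carrier L" for d
    using someI_ex[OF ex[OF that, unfolded Bex_def]] that by (simp add: f_def)
  have f_in: "f d \<in> carrier L" if "d \<in> carrier L" for d using fspec[OF that] by blast
  have f_eq: "of_nat n \<odot>\<^bsub>L\<^esub> f d = \<iota> (p h)"
    if "d \<in> carrier L" "n > 0" "h \<in> ?H" "of_nat n \<odot>\<^bsub>L\<^esub> d = \<iota> h" for d n h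
    using fspec that by blast
  have f\<iota>: "f (\<iota> h) = \<iota> (p h)" if "h \<in> ?H" for h
    using f_eq[of "\<iota> h" 1 h] Hc[OF that] f_in[of "\<iota> h"] that by simp
  have f_smult: "f (q \<odot>\<^bsub>L\<^esub> d) = q \<odot>\<^bsub>L\<^esub> f d" if d: "d \<in> carrier L" for q d
  proof -
    obtain n :: nat and h where n: "n > 0" "h \<in> ?H" "of_nat n \<odot>\<^bsub>L\<^esub> d = \<iota> h"
      using multiple_in_image[OF H d] by metis
    obtain a :: int and b :: nat where ab: "b > 0" "q = of_int a / of_nat b"
      by (metis of_int_of_nat_eq quotient_of_denom_pos quotient_of_div surj_pair zero_less_imp_eq_int)
    \<comment> \<open>With q = a / b, the multiple (b n) (q d) equals a (n d), which comes from h^a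
      in the domain, where f is known. An integer power is taken since a may be negative.\<close>
    have bq: "of_nat (b * n) * q = of_int a * of_nat n" using ab by simp
    have "of_nat (b * n) \<odot>\<^bsub>L\<^esub> (q \<odot>\<^bsub>L\<^esub> d) = of_int a \<odot>\<^bsub>L\<^esub> (of_nat n \<odot>\<^bsub>L\<^esub> d)"
      using d bq by (simp only: L.smult_smult)
    also have "\<dots> = \<iota> (h [^]\<^bsub>G\<^esub> a)" using \<iota>pow[OF n(2), of a] n(3) by simp
    finally have "of_nat (b * n) \<odot>\<^bsub>L\<^esub> f (q \<odot>\<^bsub>L\<^esub> d) = \<iota> (p (h [^]\<^bsub>G\<^esub> a))"
      using ab(1) n(1) \<iota>pow[OF n(2), of a] by (intro f_eq L.smult_in d) simp_all
    also have "\<dots> = of_int a \<odot>\<^bsub>L\<^esub> (of_nat n \<odot>\<^bsub>L\<^esub> f d)"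
      using \<iota>pow[OF n(2), of a] f_eq[OF d n] by simp
    also have "\<dots> = of_nat (b * n) \<odot>\<^bsub>L\<^esub> (q \<odot>\<^bsub>L\<^esub> f d)"
      using f_in[OF d] bq by (simp only: L.smult_smult)
    finally have "of_nat (b * n) \<odot>\<^bsub>L\<^esub> f (q \<odot>\<^bsub>L\<^esub> d) = of_nat (b * n) \<odot>\<^bsub>L\<^esub> (q \<odot>\<^bsub>L\<^esub> f d)" .
    moreover have "b * n > 0" using ab(1) n(1) by simp
    ultimately show ?thesis
      using of_nat_smult_cancel f_in[OF L.smult_in[OF d]] L.smult_in[OF f_in[OF d]] by blast
  qed
  obtain N where N: "lie_lower_central rat_ring L N = {\<zero>\<^bsub>L\<^esub>}"
    using malcev by (auto simp: is_malcev_lie_algebra_def nilpotent_lie_algebra_def)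
  have dense: "\<exists>n::nat. n > 0 \<and> of_nat n \<odot>\<^bsub>L\<^esub> d \<in> \<iota> ` ?H" if "d \<in> carrier L" for d
  proof -
    obtain n :: nat and h where "n > 0" "h \<in> ?H" "of_nat n \<odot>\<^bsub>L\<^esub> d = \<iota> h"
      using multiple_in_image[OF H \<open>d \<in> carrier L\<close>] by metis
    then show ?thesis by (metis imageI)
  qed
  have mult_closed: "of_nat n \<odot>\<^bsub>L\<^esub> d \<in> \<iota> ` ?H" if d: "d \<in> \<iota> ` ?H" for d and n :: nat
  proof -
    obtain h where "h \<in> ?H" "d = \<iota> h" using d by blast
    then show ?thesis using \<iota>npow[of h n] by (metis imageI)
  qed
  have f_bch: "f (bch L x y) = bch L (f x) (f y)" if xy: "x \<in> \<iota> ` ?H" "y \<in> \<iota> ` ?H" for x y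
  proof -
    obtain h k where hk: "h \<in> ?H" "k \<in> ?H" "x = \<iota> h" "y = \<iota> k" using xy by blast
    have "f (bch L x y) = f (\<iota> (h \<otimes>\<^bsub>G\<^esub> k))" using hk Hc \<iota>_mult by simp
    also have "\<dots> = \<iota> (p h \<otimes>\<^bsub>G\<^esub> p k)"
      using f\<iota> subgroup.m_closed[OF Hs] pmult hk by simp
    also have "\<dots> = bch L (f x) (f y)" using \<iota>_mult pc hk f\<iota> by simp
    finally show ?thesis .
  qed
  note f_hom = L.lie_hom_if_bch_hom[OF N f_in f_smult dense mult_closed f_bch]
  have inj: "inj_on f (carrier L)"
  proof (rule inj_onI)
    fix d e assume d: "d \<in> carrier L" and e: "e \<in> carrier L" and eq: "f d = f e"
    obtain m :: nat and h where m: "m > 0" "h \<in> ?H" "of_nat m \<odot>\<^bsub>L\<^esub> d = \<iota> h"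
      using multiple_in_image[OF H d] by metis
    obtain n :: nat and k where n: "n > 0" "k \<in> ?H" "of_nat n \<odot>\<^bsub>L\<^esub> e = \<iota> k"
      using multiple_in_image[OF H e] by metis
    have "\<iota> (p (h [^]\<^bsub>G\<^esub> n)) = of_nat n \<odot>\<^bsub>L\<^esub> (of_nat m \<odot>\<^bsub>L\<^esub> f d)"
      using \<iota>npow[OF m(2), of n] f_eq[OF d m] by simp
    also have "\<dots> = of_nat m \<odot>\<^bsub>L\<^esub> (of_nat n \<odot>\<^bsub>L\<^esub> f e)"
      unfolding eq L.smult_smult[OF f_in[OF e]] by (simp only: mult.commute)
    also have "\<dots> = \<iota> (p (k [^]\<^bsub>G\<^esub> m))"
      using \<iota>npow[OF n(2), of m] f_eq[OF e n] by simp
    finally have "\<iota> (p (h [^]\<^bsub>G\<^esub> n)) = \<iota> (p (k [^]\<^bsub>G\<^esub> m))" .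
    moreover have hk: "h [^]\<^bsub>G\<^esub> n \<in> ?H" "k [^]\<^bsub>G\<^esub> m \<in> ?H"
      using \<iota>npow m(2) n(2) by blast+
    ultimately have "h [^]\<^bsub>G\<^esub> n = k [^]\<^bsub>G\<^esub> m"
      using \<iota>_inj pc pinj by blast
    then have "of_nat n \<odot>\<^bsub>L\<^esub> (of_nat m \<odot>\<^bsub>L\<^esub> d) = of_nat m \<odot>\<^bsub>L\<^esub> (of_nat n \<odot>\<^bsub>L\<^esub> e)"
      unfolding m(3) n(3)
        conjunct1[OF conjunct2[OF \<iota>npow[OF m(2), of n]], symmetric]
        conjunct1[OF conjunct2[OF \<iota>npow[OF n(2), of m]], symmetric] by (rule arg_cong)
    then have "of_nat (n * m) \<odot>\<^bsub>L\<^esub> d = of_nat (n * m) \<odot>\<^bsub>L\<^esub> e"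
      unfolding L.smult_smult[OF d] L.smult_smult[OF e]
      unfolding of_nat_mult mult.commute[of "rat_of_nat m"] .
    moreover have "n * m > 0" using m(1) n(1) by simp
    ultimately show "d = e" using of_nat_smult_cancel d e by blast
  qed
  \<comment> \<open>Surjectivity rests on the density of the range: some n e comes from an element p
    h, and \<iota> h divided by n is a preimage of e.\<close>
  have "e \<in> f ` carrier L" if e: "e \<in> carrier L" for e
  proof -
    obtain n :: nat and k where n: "n > 0" "k \<in> ran \<phi>" "of_nat n \<odot>\<^bsub>L\<^esub> e = \<iota> k"
      using multiple_in_image[OF ran e] by metis
    obtain h where h: "h \<in> ?H" "k = p h" using n(2) psurj by blast
    define d where "d = (1 / of_nat n) \<odot>\<^bsub>L\<^esub> \<iota> h"
    have d: "d \<in> carrier L" using Hc h by (simp add: d_def)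
    have "of_nat n \<odot>\<^bsub>L\<^esub> d = \<iota> h" using Hc h n(1) by (simp add: d_def L.smult_smult)
    then have "of_nat n \<odot>\<^bsub>L\<^esub> f d = of_nat n \<odot>\<^bsub>L\<^esub> e" using f_eq[OF d n(1) h(1)] n(3) h(2) by simp
    then show ?thesis using of_nat_smult_cancel[OF n(1) f_in[OF d] e] d by blast
  qed
  then have "f ` carrier L = carrier L" using f_in by blast
  then have "f \<in> Bij (carrier L)"
    using inj by (simp add: Bij_def bij_betw_def extensional_def f_def)
  then have "f \<in> A" using f_hom f_smult by (simp add: lie_auto_def)
  moreover have "represents \<iota> \<phi> f" using f\<iota> by (simp add: represents_def p_def)
  ultimately show ?thesis by blast
qed

text \<open>Forwards, M is power dense in a domain and hence in G, so \<open>lie_auto_eqI\<close>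
  applies. Backwards, M is the intersection of the domains, and injectivity of \<iota> turns equal
  values in the hull into equal values in G.\<close>

lemma virtual_equiv_iff:
  assumes \<phi>: "\<phi> \<in> virtual_autos G" and \<psi>: "\<psi> \<in> virtual_autos G" and \<alpha>: "\<alpha> \<in> A" and \<beta>: "\<beta> \<in> A"
    and "represents \<iota> \<phi> \<alpha>" "represents \<iota> \<psi> \<beta>"
  shows "(\<phi>, \<psi>) \<in> virtual_equiv G \<longleftrightarrow> \<alpha> = \<beta>"
proof
  note pd\<phi> = virtual_auto_power_dense(1)[OF \<phi>] and pd\<psi> = virtual_auto_power_dense(1)[OF \<psi>]
  have s\<phi>: "subgroup (dom \<phi>) G" and s\<psi>: "subgroup (dom \<psi>) G"
    using pd\<phi> pd\<psi> by (simp_all add: power_dense_def)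
  {
    assume "(\<phi>, \<psi>) \<in> virtual_equiv G"
    then obtain M where M: "finite_index M (G\<lparr>carrier := dom \<phi>\<rparr>)" "finite_index M (G\<lparr>carrier := dom \<psi>\<rparr>)"
        "\<And>x. x \<in> M \<Longrightarrow> \<phi> x = \<psi> x"
      unfolding virtual_equiv_def by blast
    have pdM: "power_dense M (G\<lparr>carrier := dom \<phi>\<rparr>)"
      by (rule group.power_dense_if_finite_index[OF G.subgroup_imp_group[OF s\<phi>] M(1)])
    then have Ms: "subgroup M G" using G.incl_subgroup[OF s\<phi>] by (simp add: power_dense_def)
    have Msub: "M \<subseteq> dom \<phi>" "M \<subseteq> dom \<psi>"
      using M(1,2) subgroup.subset unfolding finite_index_def by fastforce+
    have "\<exists>n::nat. n > 0 \<and> g [^]\<^bsub>G\<^esub> n \<in> M" if g: "g \<in> carrier G" for g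
    proof -
      obtain m :: nat where m: "m > 0" "g [^]\<^bsub>G\<^esub> m \<in> dom \<phi>"
        using pd\<phi> g unfolding power_dense_def by blast
      then obtain n :: nat where n: "n > 0" "(g [^]\<^bsub>G\<^esub> m) [^]\<^bsub>G\<^esub> n \<in> M"
        using pdM unfolding power_dense_def by (auto simp flip: G.nat_pow_consistent)
      then show ?thesis using m g by (intro exI[of _ "m * n"]) (simp add: G.nat_pow_pow)
    qed
    then have "power_dense M G" using Ms by (simp add: power_dense_def)
    moreover have "\<alpha> (\<iota> x) = \<beta> (\<iota> x)" if "x \<in> M" for x
      using assms(5,6) M(3)[OF that] Msub that unfolding represents_def by (metis subsetD)
    ultimately show "\<alpha> = \<beta>" using lie_auto_eqI[OF \<alpha> \<beta>] by blast
  }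
  assume eq: "\<alpha> = \<beta>"
  let ?M = "dom \<phi> \<inter> dom \<psi>"
  have "finite_index ?M G"
    using G.finite_index_if_power_dense[OF fg nil_G G.power_dense_Int[OF pd\<phi> pd\<psi>]] .
  then have "finite_index ?M (G\<lparr>carrier := dom \<phi>\<rparr>)" "finite_index ?M (G\<lparr>carrier := dom \<psi>\<rparr>)"
    using G.finite_index_in_subgroup s\<phi> s\<psi> by blast+
  moreover have "\<phi> x = \<psi> x" if "x \<in> ?M" for x
  proof -
    have "\<iota> (the (\<phi> x)) = \<iota> (the (\<psi> x))" using assms(5,6) that eq by (simp add: represents_def)
    then have "the (\<phi> x) = the (\<psi> x)"
      using \<iota>_inj virtual_auto_in(3)[OF \<phi>] virtual_auto_in(3)[OF \<psi>] that by blast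
    then show ?thesis using that by auto
  qed
  ultimately show "(\<phi>, \<psi>) \<in> virtual_equiv G" using \<phi> \<psi> unfolding virtual_equiv_def by blast
qed

text \<open>By \<open>virtual_autosI\<close> the main point is the domain of the composite: g^m
  enters the domain of \<psi>, a further power n brings its image into that of \<phi>, and so g^(m
  n) belongs to the domain.\<close>

lemma map_comp_virtual_auto:
  assumes \<phi>: "\<phi> \<in> virtual_autos G" and \<psi>: "\<psi> \<in> virtual_autos G" and \<alpha>: "\<alpha> \<in> A" and \<beta>: "\<beta> \<in> A"
    and "represents \<iota> \<phi> \<alpha>" "represents \<iota> \<psi> \<beta>"
  shows "\<phi> \<circ>\<^sub>m \<psi> \<in> virtual_autos G" "represents \<iota> (\<phi> \<circ>\<^sub>m \<psi>) (compose (carrier L) \<alpha> \<beta>)"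
proof -
  define p where "p x = the (\<psi> x)" for x
  have dom: "dom (\<phi> \<circ>\<^sub>m \<psi>) = {x \<in> dom \<psi>. p x \<in> dom \<phi>}"
    by (auto simp: map_comp_def p_def split: option.splits)
  have the: "the ((\<phi> \<circ>\<^sub>m \<psi>) x) = the (\<phi> (p x))" if "x \<in> dom \<psi>" for x
    using that by (auto simp: map_comp_def p_def)
  show rep: "represents \<iota> (\<phi> \<circ>\<^sub>m \<psi>) (compose (carrier L) \<alpha> \<beta>)"
    using assms(5,6) \<iota>_in virtual_auto_in(1)[OF \<psi>]
    by (simp add: represents_def dom the compose_def p_def)
  note pd\<phi> = virtual_auto_power_dense(1)[OF \<phi>] and pd\<psi> = virtual_auto_power_dense(1)[OF \<psi>]
  have s\<phi>: "subgroup (dom \<phi>) G" and s\<psi>: "subgroup (dom \<psi>) G"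
    using pd\<phi> pd\<psi> by (simp_all add: power_dense_def)
  have "p \<in> iso (G\<lparr>carrier := dom \<psi>\<rparr>) (G\<lparr>carrier := ran \<psi>\<rparr>)"
    using \<psi> unfolding virtual_autos_def p_def by simp
  then have hom: "group_hom (G\<lparr>carrier := dom \<psi>\<rparr>) G p"
    unfolding group_hom_def group_hom_axioms_def
    using G.subgroup_imp_group[OF s\<psi>] G.group_axioms virtual_auto_in(3)[OF \<psi>]
    by (auto simp: iso_def hom_def p_def)
  interpret p: group_hom "G\<lparr>carrier := dom \<psi>\<rparr>" G p by (rule hom)
  have "subgroup (dom (\<phi> \<circ>\<^sub>m \<psi>)) G"
  proof (rule G.subgroupI)
    show "dom (\<phi> \<circ>\<^sub>m \<psi>) \<subseteq> carrier G" using dom virtual_auto_in(1)[OF \<psi>] by blast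
    show "dom (\<phi> \<circ>\<^sub>m \<psi>) \<noteq> {}"
      using p.hom_one subgroup.one_closed[OF s\<phi>] subgroup.one_closed[OF s\<psi>] dom by force
    show "inv\<^bsub>G\<^esub> a \<in> dom (\<phi> \<circ>\<^sub>m \<psi>)" if "a \<in> dom (\<phi> \<circ>\<^sub>m \<psi>)" for a
      using that p.hom_inv[of a] G.m_inv_consistent[OF s\<psi>, of a] subgroup.m_inv_closed[OF s\<phi>]
        subgroup.m_inv_closed[OF s\<psi>] by (simp add: dom)
    show "a \<otimes>\<^bsub>G\<^esub> b \<in> dom (\<phi> \<circ>\<^sub>m \<psi>)" if "a \<in> dom (\<phi> \<circ>\<^sub>m \<psi>)" "b \<in> dom (\<phi> \<circ>\<^sub>m \<psi>)" for a b
      using that p.hom_mult[of a b] subgroup.m_closed[OF s\<phi>] subgroup.m_closed[OF s\<psi>]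
      by (simp add: dom)
  qed
  moreover have "\<exists>n::nat. n > 0 \<and> g [^]\<^bsub>G\<^esub> n \<in> dom (\<phi> \<circ>\<^sub>m \<psi>)" if g: "g \<in> carrier G" for g
  proof -
    obtain m :: nat where m: "m > 0" "g [^]\<^bsub>G\<^esub> m \<in> dom \<psi>"
      using pd\<psi> g unfolding power_dense_def by blast
    obtain n :: nat where n: "n > 0" "p (g [^]\<^bsub>G\<^esub> m) [^]\<^bsub>G\<^esub> n \<in> dom \<phi>"
      using pd\<phi> virtual_auto_in(3)[OF \<psi> m(2)] unfolding power_dense_def p_def by blast
    have "p (g [^]\<^bsub>G\<^esub> (m * n)) = p (g [^]\<^bsub>G\<^esub> m) [^]\<^bsub>G\<^esub> n"
      using p.hom_nat_pow[of "g [^]\<^bsub>G\<^esub> m" n] m g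
      by (simp add: G.nat_pow_pow flip: G.nat_pow_consistent)
    then have "g [^]\<^bsub>G\<^esub> (m * n) \<in> dom (\<phi> \<circ>\<^sub>m \<psi>)"
      using n G.power_dense_pow_mult[OF pd\<psi> m(2) g, of n] by (simp add: dom)
    then show ?thesis using m n by (intro exI[of _ "m * n"]) simp
  qed
  ultimately have "power_dense (dom (\<phi> \<circ>\<^sub>m \<psi>)) G" by (simp add: power_dense_def)
  moreover have "ran (\<phi> \<circ>\<^sub>m \<psi>) \<subseteq> ran \<phi>"
    by (auto simp: ran_def map_comp_def split: option.splits)
  then have "ran (\<phi> \<circ>\<^sub>m \<psi>) \<subseteq> carrier G"
    using virtual_auto_power_dense(2)[OF \<phi>] subgroup.subset unfolding power_dense_def by blast
  ultimately show "\<phi> \<circ>\<^sub>m \<psi> \<in> virtual_autos G"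
    using virtual_autosI[OF compose_lie_auto[OF \<alpha> \<beta>] _ rep] by blast
qed

text \<open>The class of the commutator group element attached to \<alpha>, given by all its members
  so that no representative is chosen; for \<alpha> in \<open>A\<close> it is an equivalence class
  by \<open>virtual_equiv_Image\<close>.\<close>

definition comm_class :: "('d \<Rightarrow> 'd) \<Rightarrow> ('a \<rightharpoonup> 'a) set" where
  "comm_class \<alpha> = {\<phi> \<in> virtual_autos G. represents \<iota> \<phi> \<alpha>}"

lemma virtual_equiv_Image:
  assumes "\<alpha> \<in> A" "\<phi> \<in> comm_class \<alpha>"
  shows "virtual_equiv G `` {\<phi>} = comm_class \<alpha>"
proof (rule Set.set_eqI)
  fix \<psi>
  show "\<psi> \<in> virtual_equiv G `` {\<phi>} \<longleftrightarrow> \<psi> \<in> comm_class \<alpha>"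
  proof (cases "\<psi> \<in> virtual_autos G")
    case True
    then obtain \<beta> where "\<beta> \<in> A" "represents \<iota> \<psi> \<beta>" using virtual_auto_represents by blast
    then show ?thesis
      using assms True virtual_equiv_iff[of \<phi> \<psi> \<alpha> \<beta>] virtual_equiv_iff[of \<phi> \<psi> \<alpha> \<alpha>]
      unfolding comm_class_def by auto
  next
    case False
    then show ?thesis by (auto simp: comm_class_def virtual_equiv_def)
  qed
qed

lemma comm_class_nonempty: "\<alpha> \<in> A \<Longrightarrow> comm_class \<alpha> \<noteq> {}"
  using lie_auto_represented unfolding comm_class_def by blast

lemma comm_class_bij: "bij_betw comm_class A (carrier (Comm G))"
  unfolding bij_betw_def
proof
  show "inj_on comm_class A"
  proof (rule inj_onI)
    fix \<alpha> \<beta> assume ab: "\<alpha> \<in> A" "\<beta> \<in> A" "comm_class \<alpha> = comm_class \<beta>"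
    then obtain \<phi> where "\<phi> \<in> virtual_autos G" "represents \<iota> \<phi> \<alpha>" "represents \<iota> \<phi> \<beta>"
      using comm_class_nonempty unfolding comm_class_def by blast
    then show "\<alpha> = \<beta>"
      using lie_auto_eqI[OF ab(1,2) virtual_auto_power_dense(1)] by (metis represents_def)
  qed
  have "carrier (Comm G) = (\<lambda>\<phi>. virtual_equiv G `` {\<phi>}) ` virtual_autos G"
    by (auto simp: Comm_def quotient_def)
  also have "\<dots> = comm_class ` A"
  proof
    show "(\<lambda>\<phi>. virtual_equiv G `` {\<phi>}) ` virtual_autos G \<subseteq> comm_class ` A"
      using virtual_auto_represents virtual_equiv_Image unfolding comm_class_def by fastforce
    show "comm_class ` A \<subseteq> (\<lambda>\<phi>. virtual_equiv G `` {\<phi>}) ` virtual_autos G"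
    proof clarify
      fix \<alpha> assume \<alpha>: "\<alpha> \<in> A"
      then obtain \<phi> where "\<phi> \<in> comm_class \<alpha>" using comm_class_nonempty by blast
      then show "comm_class \<alpha> \<in> (\<lambda>\<phi>. virtual_equiv G `` {\<phi>}) ` virtual_autos G"
        using virtual_equiv_Image[OF \<alpha>] unfolding comm_class_def by blast
    qed
  qed
  finally show "comm_class ` A = carrier (Comm G)" by simp
qed

text \<open>The double union in \<open>Comm\<close> runs over a nonempty constant family, since all
  composites of members are represented by the same automorphism.\<close>

lemma comm_class_mult:
  assumes \<alpha>: "\<alpha> \<in> A" and \<beta>: "\<beta> \<in> A"
  shows "comm_class \<alpha> \<otimes>\<^bsub>Comm G\<^esub> comm_class \<beta> = comm_class (compose (carrier L) \<alpha> \<beta>)"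
proof -
  have "virtual_equiv G `` {\<phi> \<circ>\<^sub>m \<psi>} = comm_class (compose (carrier L) \<alpha> \<beta>)"
    if "\<phi> \<in> comm_class \<alpha>" "\<psi> \<in> comm_class \<beta>" for \<phi> \<psi>
    using that map_comp_virtual_auto[OF _ _ \<alpha> \<beta>] virtual_equiv_Image[OF compose_lie_auto[OF \<alpha> \<beta>]]
    by (simp add: comm_class_def)
  then have "comm_class \<alpha> \<otimes>\<^bsub>Comm G\<^esub> comm_class \<beta> =
      (\<Union>\<phi>\<in>comm_class \<alpha>. \<Union>\<psi>\<in>comm_class \<beta>. comm_class (compose (carrier L) \<alpha> \<beta>))"
    by (simp add: Comm_def)
  then show ?thesis using comm_class_nonempty \<alpha> \<beta> by simp
qed

theorem Comm_iso_LieAutoGroup: "Comm G \<cong> LieAutoGroup rat_ring L"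
proof -
  \<comment> \<open>The inverse sends a class to the unique automorphism of L that represents its
    members.\<close>
  let ?h = "inv_into A comm_class"
  have carrier: "carrier (LieAutoGroup rat_ring L) = A" by (simp add: LieAutoGroup_def)
  have bij: "bij_betw ?h (carrier (Comm G)) A" by (rule bij_betw_inv_into[OF comm_class_bij])
  have "?h (x \<otimes>\<^bsub>Comm G\<^esub> y) = ?h x \<otimes>\<^bsub>LieAutoGroup rat_ring L\<^esub> ?h y"
    if "x \<in> carrier (Comm G)" "y \<in> carrier (Comm G)" for x y
  proof -
    have "x \<in> comm_class ` A" "y \<in> comm_class ` A"
      using that comm_class_bij by (simp_all only: bij_betw_def)
    then obtain \<alpha> \<beta> where ab: "\<alpha> \<in> A" "\<beta> \<in> A" "x = comm_class \<alpha>" "y = comm_class \<beta>" by blast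
    have inv: "?h (comm_class \<gamma>) = \<gamma>" if "\<gamma> \<in> A" for \<gamma>
      by (rule inv_into_f_f[OF bij_betw_imp_inj_on[OF comm_class_bij] that])
    have "\<alpha> \<otimes>\<^bsub>LieAutoGroup rat_ring L\<^esub> \<beta> = compose (carrier L) \<alpha> \<beta>"
      using ab by (simp add: LieAutoGroup_def BijGroup_def lie_auto_def)
    then show ?thesis using ab inv comm_class_mult compose_lie_auto by simp
  qed
  then have "?h \<in> iso (Comm G) (LieAutoGroup rat_ring L)"
    using bij carrier by (auto simp: iso_def hom_def bij_betw_def)
  then show ?thesis by (rule is_isoI)
qed

end

theorem theorem3p2:
  fixes G :: "('a, 'b) monoid_scheme"
    and D :: "('d, 'e) monoid_scheme"
    and \<iota> :: "'a \<Rightarrow> 'd"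
    and L :: "(rat, 'd, 'c) lie_alg_scheme"
  assumes "group G"
    and "finitely_generated G"
    and "torsion_free G"
    and "nilpotent_group G"
    and "is_divisible_hull G \<iota> D"
    and "is_malcev_lie_algebra D L"
  shows "Comm G \<cong> LieAutoGroup rat_ring L"
proof -
  interpret malcev_hull G D \<iota> L using assms by (intro malcev_hull.intro)
  show ?thesis by (rule Comm_iso_LieAutoGroup)
qed

end
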